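(* Let $\mathbb{F}$ be an arbitrary field and let $n \geq 2$ be an integer. Assume that $\mathbb{F}$ is not a finite field of characteristic $2$. Then $t_n(\mathbb{F})=\frac{n(n+1)}{2}$ if and only if $\mathbb{F}$ is not quadratically closed.
   Context: $\mathrm{M}_n(\mathbb{F})$ denotes the space of $n\times n$ matrices over the field $\mathbb{F}$. A matrix is triangularizable over $\mathbb{F}$ if it is similar, over $\mathbb{F}$, to an upper-triangular matrix with entries in $\mathbb{F}$. A linear subspace of $\mathrm{M}_n(\mathbb{F})$ is called weakly triangularizable when all its elements are triangularizable over $\mathbb{F}$. $t_n(\mathbb{F})$ denotes the greatest possible dimension of a weakly triangularizable linear subspace of $\mathrm{M}_n(\mathbb{F})$. The field $\mathbb{F}$ is called quadratically closed when every polynomial of degree $2$ in $\mathbb{F}[t]$ splits over $\mathbb{F}$ (this definition is used in every characteristic, including $2$). *)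

theory Defs
  imports "Jordan_Normal_Form.VS_Connect" "HOL-Computational_Algebra.Polynomial"
begin

definition triangularizable :: "'a::field mat \<Rightarrow> bool" where
  "triangularizable A \<longleftrightarrow> (\<exists>B. similar_mat A B \<and> upper_triangular B)"

definition weakly_triangularizable_subspace :: "nat \<Rightarrow> 'a::field mat set \<Rightarrow> bool" where
  "weakly_triangularizable_subspace n W \<longleftrightarrow>
     VectorSpace.subspace class_ring W (module_mat TYPE('a) n n) \<and> (\<forall>A\<in>W. triangularizable A)"

definition mat_subspace_dim :: "nat \<Rightarrow> 'a::field mat set \<Rightarrow> nat" where
  "mat_subspace_dim n W =
     vectorspace.dim class_ring ((module_mat TYPE('a) n n) \<lparr>carrier := W\<rparr>)"

text \<open>
  \<open>Max\<close> is meaningful here: the zero subspace is weakly triangularizable,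
  and every subspace has dimension at most \<open>n\<^sup>2\<close>.
\<close>
definition triang_dim :: "'a::field itself \<Rightarrow> nat \<Rightarrow> nat" where
  "triang_dim F n =
     Max {mat_subspace_dim n W | W :: 'a mat set. weakly_triangularizable_subspace n W}"

definition poly_splits :: "'a::field poly \<Rightarrow> bool" where
  "poly_splits p \<longleftrightarrow> (\<exists>c as. p = Polynomial.smult c (\<Prod>a\<leftarrow>as. [:-a, 1:]))"

definition quadratically_closed :: "'a::field itself \<Rightarrow> bool" where
  "quadratically_closed F \<longleftrightarrow> (\<forall>p :: 'a poly. degree p = 2 \<longrightarrow> poly_splits p)"

end

theory Submission
  imports Defs "Jordan_Normal_Form.Char_Poly" "HOL-Library.Ramsey"
begin

text \<open>
  The upper triangular matrices give the lower bound \<open>n (n + 1) / 2\<close>. If the field is quadratically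
  closed, then every \<open>2 \<times> 2\<close> matrix is triangularizable, so the entry \<open>(1, 0)\<close> may be freed as well
  and the dimension exceeds \<open>n (n + 1) / 2\<close> by one. The substance is the upper bound over a field that
  is not quadratically closed (\<open>split_subspace_separated\<close>).

  Let \<open>V\<close> be a space of matrices with split characteristic polynomials, acting on column vectors, and
  let \<open>X\<close> span a subspace \<open>P\<close> of dimension \<open>d\<close>. The elements of \<open>V\<close> that leave \<open>P\<close> invariant act on \<open>P\<close>
  and on the quotient by \<open>P\<close>, again with split characteristic polynomials, and they form a subspace of
  codimension at most \<open>d (n - d)\<close>. If no nonzero element of \<open>V\<close> kills \<open>P\<close> and maps everything into
  \<open>P\<close>, then such an element is determined by these two actions, and induction gives the bound,
  because the numbers \<open>n (n + 1) / 2\<close> satisfy the matching recursion (\<open>separating_block\<close>). So a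
  counterexample contains, for every such \<open>P\<close>, a nonzero element of the form \<open>X L\<close> with \<open>L X = 0\<close>.

  Take \<open>d = 1\<close>. For each vector \<open>x\<close> with first coordinate 1 there is a functional \<open>\<phi>\<^sub>x \<noteq> 0\<close> with
  \<open>\<phi>\<^sub>x(x) = 0\<close> and \<open>x \<phi>\<^sub>x \<in> V\<close>. A double count produces two vectors with \<open>\<phi>\<^sub>x(y) \<noteq> 0\<close> and
  \<open>\<phi>\<^sub>y(x) \<noteq> 0\<close>: a nonzero functional vanishes on at most half of the vectors with first coordinate 1 if the
  field is finite, and on fewer than \<open>n\<close> points of the moment curve \<open>(1, t, t\<^sup>2, \<dots>)\<close> in general. Then
  \<open>a x \<phi>\<^sub>x + y \<phi>\<^sub>y\<close> has, up to a power of \<open>t\<close>, the characteristic polynomial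
  \<open>t\<^sup>2 - a \<phi>\<^sub>x(y) \<phi>\<^sub>y(x)\<close>, so every scalar is a square. Away from characteristic 2 this already makes
  the field quadratically closed.

  There remain infinite perfect fields of characteristic 2, in which some \<open>z\<^sup>2 + z + 1 + k\<close> with \<open>k \<noteq> 0\<close>
  has no root. Ramsey's theorem turns the double count into an infinite set of points of the moment curve
  with \<open>\<phi>\<^sub>x(y) \<noteq> 0\<close> for all distinct \<open>x\<close>, \<open>y\<close> among them (\<open>mutual_moment_clique\<close>). Take
  \<open>d = 2\<close> and let \<open>P\<close> be spanned by two of them; a third one \<open>z\<close> can be chosen that is not killed by the
  element \<open>X L\<close> found above. Combining \<open>X L\<close> with the three rank-one elements at \<open>x\<close>, \<open>y\<close>, \<open>z\<close> gives
  \<open>3 \<times> 3\<close> matrices with zero diagonal whose characteristic polynomials \<open>t\<^sup>3 + p t + q\<close> must all split,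
  and the quadratic resolvent of such a cubic excludes \<open>p\<^sup>3 = k q\<^sup>2 \<noteq> 0\<close>. There are enough free
  parameters to reach this relation unless \<open>X L\<close> kills \<open>z\<close>, which is the contradiction.
\<close>

section \<open>Split polynomials and fields that are not quadratically closed\<close>

text \<open>
  By induction on the roots: each of them is a root of one of the two factors, and the corresponding
  linear polynomial can be cancelled there.
\<close>
lemma poly_splits_mult_imp_right:
  fixes p q :: "'a::field poly"
  assumes "poly_splits (p * q)" "p * q \<noteq> 0"
  shows "poly_splits q"
proof -
  have "poly_splits q" if "p * q = Polynomial.smult c (\<Prod>a\<leftarrow>as. [:-a, 1:])" "c \<noteq> 0"
    for c :: 'a and as and p q :: "'a poly"
    using that
  proof (induction as arbitrary: p q)
    case Nil
    then have pq: "p * q = [:c:]" by simp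
    then have "p * q \<noteq> 0" using Nil(2) by simp
    then have "p \<noteq> 0" "q \<noteq> 0" by auto
    then have "degree p + degree q = 0" using pq degree_mult_eq[of p q] by simp
    then obtain d where "q = [:d:]" by (metis add_is_0 degree_eq_zeroE)
    then have "q = Polynomial.smult d (\<Prod>a\<leftarrow>[]. [:-a, 1:])" by simp
    then show ?case unfolding poly_splits_def by blast
  next
    case (Cons a as)
    let ?P = "(\<Prod>a\<leftarrow>as. [:-a, 1:]) :: 'a poly"
    have e: "p * q = [:-a, 1:] * Polynomial.smult c ?P" using Cons.prems by simp
    then have "poly (p * q) a = 0" by simp
    then consider "[:-a, 1:] dvd p" | "[:-a, 1:] dvd q" by (auto simp: poly_eq_0_iff_dvd)
    then show ?case
    proof cases
      case 1
      then obtain p' where "p = [:-a, 1:] * p'" by auto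
      then have "[:-a, 1:] * (p' * q) = [:-a, 1:] * Polynomial.smult c ?P" using e by (simp only: mult.assoc)
      then have "p' * q = Polynomial.smult c ?P" by (subst (asm) mult_cancel_left) auto
      then show ?thesis using Cons by blast
    next
      case 2
      then obtain q' where q: "q = [:-a, 1:] * q'" by auto
      then have "[:-a, 1:] * (p * q') = [:-a, 1:] * Polynomial.smult c ?P" using e by (simp only: mult.left_commute)
      then have "p * q' = Polynomial.smult c ?P" by (subst (asm) mult_cancel_left) auto
      then have "poly_splits q'" using Cons by blast
      then obtain d bs where "q' = Polynomial.smult d (\<Prod>a\<leftarrow>bs. [:-a, 1:])" unfolding poly_splits_def by blast
      then have "q = Polynomial.smult d (\<Prod>a\<leftarrow>a # bs. [:-a, 1:])" by (simp add: q)
      then show ?thesis unfolding poly_splits_def by blast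
    qed
  qed
  then show ?thesis using assms unfolding poly_splits_def by (metis smult_0_left)
qed

lemma poly_splits_mult:
  fixes p q :: "'a::field poly"
  assumes "poly_splits p" "poly_splits q"
  shows "poly_splits (p * q)"
proof -
  obtain c as d bs where "p = Polynomial.smult c (\<Prod>a\<leftarrow>as. [:-a, 1:])" "q = Polynomial.smult d (\<Prod>a\<leftarrow>bs. [:-a, 1:])"
    using assms unfolding poly_splits_def by blast
  then have "p * q = Polynomial.smult (c * d) (\<Prod>a\<leftarrow>as @ bs. [:-a, 1:])" by (simp add: mult.commute)
  then show ?thesis unfolding poly_splits_def by blast
qed

lemma poly_splits_quadratic_iff:
  fixes p :: "'a::field poly"
  assumes "degree p = 2"
  shows "poly_splits p \<longleftrightarrow> (\<exists>r. poly p r = 0)"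
proof
  assume "poly_splits p"
  then obtain c as where p: "p = Polynomial.smult c (\<Prod>a\<leftarrow>as. [:-a, 1:])" unfolding poly_splits_def by blast
  with assms obtain a bs where "as = a # bs" by (cases as) (auto split: if_splits)
  then have "poly p a = 0" using p by simp
  then show "\<exists>r. poly p r = 0" ..
next
  assume "\<exists>r. poly p r = 0"
  then obtain r where "poly p r = 0" ..
  then obtain q where q: "p = [:-r, 1:] * q" by (auto simp: poly_eq_0_iff_dvd)
  with assms have "q \<noteq> 0" by auto
  then have "degree q = 1" using assms q degree_mult_eq[of "[:-r, 1:]" q] by simp
  then obtain u v where uv: "q = [:u, v:]" "v \<noteq> 0" by (metis degree1_coeffs)
  have "p = Polynomial.smult v (\<Prod>a\<leftarrow>[r, -u/v]. [:-a, 1:])" using uv(2) by (simp add: q uv(1) field_simps)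
  then show "poly_splits p" unfolding poly_splits_def by blast
qed

lemma poly_splits_monic_cubic:
  fixes p :: "'a::field poly"
  assumes "poly_splits p" "degree p = 3" "coeff p 3 = 1"
  obtains r s t where "p = [:-r, 1:] * [:-s, 1:] * [:-t, 1:]"
proof -
  obtain c as where p: "p = Polynomial.smult c (\<Prod>a\<leftarrow>as. [:-a, 1:])"
    using assms(1) unfolding poly_splits_def by blast
  have m: "degree (\<Prod>a\<leftarrow>as. [:-a, 1:]) = length as"
    by (rule degree_linear_factors)
  have m1: "lead_coeff (\<Prod>a\<leftarrow>as. [:-a, 1:]) = 1"
    by (induction as) (simp_all add: lead_coeff_mult del: mult_pCons_left)
  have "c \<noteq> 0" using p assms by auto
  then have l: "length as = 3" using p m assms by simp
  then have "c = 1" using p m m1 assms by simp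
  moreover obtain r s t where "as = [r, s, t]" using l by (auto simp: numeral_3_eq_3 length_Suc_conv)
  ultimately show ?thesis using that[of r s t] p by (simp only: mult.assoc) simp
qed

lemma not_quadratically_closed_irreducible:
  assumes "\<not> quadratically_closed TYPE('a::field)"
  obtains b c :: "'a::field" where "\<And>t. t\<^sup>2 + b * t + c \<noteq> 0"
proof -
  obtain p :: "'a poly" where p: "degree p = 2" "\<not> poly_splits p"
    using assms unfolding quadratically_closed_def by blast
  obtain c b a where abc: "p = [:c, b, a:]" "a \<noteq> 0" using p(1) by (metis degree2_coeffs)
  show ?thesis
  proof (rule that[of "b / a" "c / a"])
    fix t
    have "poly p t \<noteq> 0" using p poly_splits_quadratic_iff by blast
    then show "t\<^sup>2 + b / a * t + c / a \<noteq> 0" using abc(2) by (simp add: abc(1) field_simps power2_eq_square)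
  qed
qed

lemma quadratically_closed_root:
  fixes b c :: "'a::field"
  assumes "quadratically_closed TYPE('a)"
  shows "\<exists>t. t\<^sup>2 + b * t + c = 0"
proof -
  from assms have "poly_splits [:c, b, 1:]" unfolding quadratically_closed_def by simp
  then obtain r where "poly [:c, b, 1:] r = 0" by (subst (asm) poly_splits_quadratic_iff) auto
  then show ?thesis by (intro exI[of _ r]) (simp add: power2_eq_square algebra_simps)
qed

text \<open>
  Completing the square, which needs a division by 2.
\<close>
lemma all_squares_imp_char_2:
  assumes nqc: "\<not> quadratically_closed TYPE('a::field)"
    and sq: "\<And>a::'a::field. \<exists>r. r\<^sup>2 = a"
  shows "(2::'a::field) = 0"
proof (rule ccontr)
  assume 2: "(2::'a) \<noteq> 0"
  obtain b c :: 'a where bc: "\<And>t. t\<^sup>2 + b * t + c \<noteq> 0" using not_quadratically_closed_irreducible[OF nqc] by blast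
  define h where "h = b / 2"
  have b: "b = 2 * h" using 2 by (simp add: h_def)
  obtain r where r: "r\<^sup>2 = h\<^sup>2 - c" using sq by blast
  have "(r - h)\<^sup>2 + b * (r - h) + c = r\<^sup>2 - h\<^sup>2 + c"
    by (simp add: b power2_eq_square algebra_simps)
  then show False using bc[of "r - h"] r by simp
qed

text \<open>
  Over a perfect field of characteristic 2 a quadratic polynomial without roots has a nonzero linear
  coefficient, and scaling the variable normalizes it to \<open>z\<^sup>2 + z + d\<close>. Adding a value
  \<open>\<theta>\<^sup>2 + \<theta>\<close> to \<open>d\<close> does not affect the existence of roots; this freedom is used to reach \<open>d \<noteq> 1\<close>,
  which is what \<open>k \<noteq> 0\<close> asks for.
\<close>
lemma artin_schreier_nonroot:
  assumes nqc: "\<not> quadratically_closed TYPE('a::field)" and 2: "(2::'a::field) = 0"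
    and sq: "\<And>a::'a::field. \<exists>r. r\<^sup>2 = a" and inf: "infinite (UNIV :: 'a::field set)"
  obtains k :: "'a::field" where "k \<noteq> 0" "\<And>z. z\<^sup>2 + z \<noteq> 1 + k"
proof -
  obtain b c :: 'a where bc: "\<And>t. t\<^sup>2 + b * t + c \<noteq> 0" using not_quadratically_closed_irreducible[OF nqc] by blast
  have neg: "- x = x" for x :: 'a using 2 by (metis add_eq_0_iff mult_2 mult_zero_left)
  have "b \<noteq> 0"
  proof
    assume "b = 0"
    obtain r where "r\<^sup>2 = - c" using sq by blast
    then show False using bc[of r] \<open>b = 0\<close> by simp
  qed
  have d: "z\<^sup>2 + z \<noteq> c / b\<^sup>2" for z
  proof
    assume "z\<^sup>2 + z = c / b\<^sup>2"
    then have "c = b\<^sup>2 * (z\<^sup>2 + z)" using \<open>b \<noteq> 0\<close> by simp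
    then have "(b * z)\<^sup>2 + b * (b * z) + c = 2 * (b\<^sup>2 * (z\<^sup>2 + z))" by (simp add: power2_eq_square algebra_simps)
    then show False using bc[of "b * z"] 2 by simp
  qed
  have "finite {0, 1 :: 'a}" by simp
  then obtain \<theta> :: 'a where th: "\<theta> \<noteq> 0" "\<theta> \<noteq> 1" using ex_new_if_finite[OF inf] by blast
  have th2: "\<theta>\<^sup>2 + \<theta> \<noteq> 0"
  proof
    assume "\<theta>\<^sup>2 + \<theta> = 0"
    then have "\<theta> * (\<theta> + 1) = 0" by (simp add: power2_eq_square algebra_simps)
    then show False using th neg[of 1] by (auto simp: add_eq_0_iff2)
  qed
  define e where "e = (if c / b\<^sup>2 = 1 then \<theta>\<^sup>2 + \<theta> else 0)"
  have "\<exists>x. e = x\<^sup>2 + x"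
  proof (cases "c / b\<^sup>2 = 1")
    case True
    then show ?thesis unfolding e_def by auto
  next
    case False
    then have "e = 0\<^sup>2 + 0" unfolding e_def by (simp only: if_False) simp
    then show ?thesis by blast
  qed
  then obtain \<theta>' where e: "e = \<theta>'\<^sup>2 + \<theta>'" by blast
  show ?thesis
  proof (rule that[of "c / b\<^sup>2 - 1 + e"])
    show "c / b\<^sup>2 - 1 + e \<noteq> 0"
      by (cases "c / b\<^sup>2 = 1") (use th2 in \<open>simp_all only: e_def if_True if_False diff_self add_0_left add_0_right right_minus_eq not_False_eq_True simp_thms\<close>)
    fix z
    have "(z + \<theta>')\<^sup>2 + (z + \<theta>') = z\<^sup>2 + z + e + 2 * (z * \<theta>')" unfolding e by (simp add: power2_eq_square algebra_simps)
    also have "\<dots> = z\<^sup>2 + z + e" using 2 by simp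
    finally have "z\<^sup>2 + z + e \<noteq> c / b\<^sup>2" using d[of "z + \<theta>'"] by metis
    moreover have "1 + (c / b\<^sup>2 - 1 + e) + e = c / b\<^sup>2 + 2 * e" by simp
    ultimately show "z\<^sup>2 + z \<noteq> 1 + (c / b\<^sup>2 - 1 + e)" using 2 by (metis add_0_right mult_zero_left)
  qed
qed

text \<open>
  In characteristic 2 the discriminant of a cubic is always a square, and the polynomial
  \<open>z\<^sup>2 + q z + p\<^sup>3 + q\<^sup>2\<close> takes over its role: its roots are the two cyclic sums
  \<open>r\<^sup>2 s + s\<^sup>2 t + t\<^sup>2 r\<close> and \<open>s\<^sup>2 r + t\<^sup>2 s + r\<^sup>2 t\<close>.
\<close>
lemma char_2_cubic_resolvent:
  fixes r s t :: "'a::field"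
  assumes 2: "(2::'a) = 0" and "r + s + t = 0"
  defines "p \<equiv> r * s + s * t + t * r" and "q \<equiv> r * s * t"
  shows "\<exists>z. z\<^sup>2 + q * z + p ^ 3 + q\<^sup>2 = 0"
proof -
  have t: "t = - (r + s)" using assms(2) by (metis add_eq_0_iff)
  define z where "z = r\<^sup>2 * s + s\<^sup>2 * t + t\<^sup>2 * r"
  define w where "w = z\<^sup>2 + q * z + p ^ 3 + q\<^sup>2"
  \<comment> \<open>the integer identity behind the vanishing of \<open>w\<close> modulo 2\<close>
  have "w = 2 * (r ^ 5 * s - 5 * r ^ 3 * s ^ 3 - 5 * r\<^sup>2 * s ^ 4 - r * s ^ 5)"
    unfolding w_def z_def p_def q_def t
    by (simp add: eval_nat_numeral algebra_simps)
  then have "w = 0" using 2 by simp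
  then show ?thesis unfolding w_def by blast
qed

section \<open>Characteristic polynomials of block matrices and of products\<close>

lemma char_poly_four_block_lower_left_zero:
  fixes A B D :: "'a::field mat"
  assumes A: "A \<in> carrier_mat n n" and B: "B \<in> carrier_mat n m" and D: "D \<in> carrier_mat m m"
  shows "char_poly (four_block_mat A B (0\<^sub>m m n) D) = char_poly A * char_poly D"
proof -
  let ?c = "map_mat (\<lambda>a. [:- a:])"
  have "char_poly_matrix (four_block_mat A B (0\<^sub>m m n) D)
      = four_block_mat (char_poly_matrix A) (?c B) (0\<^sub>m m n) (char_poly_matrix D)"
    using A B D by (intro eq_matI) (auto simp: char_poly_matrix_def one_poly_def)
  then show ?thesis
    unfolding char_poly_def using A B D
    by (simp, intro det_four_block_mat_lower_left_zero[of _ n _ m]) auto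
qed

lemma char_poly_four_block_upper_right_zero:
  fixes A C D :: "'a::field mat"
  assumes A: "A \<in> carrier_mat n n" and C: "C \<in> carrier_mat m n" and D: "D \<in> carrier_mat m m"
  shows "char_poly (four_block_mat A (0\<^sub>m n m) C D) = char_poly A * char_poly D"
proof -
  let ?c = "map_mat (\<lambda>a. [:- a:])"
  have "char_poly_matrix (four_block_mat A (0\<^sub>m n m) C D)
      = four_block_mat (char_poly_matrix A) (0\<^sub>m n m) (?c C) (char_poly_matrix D)"
    using A C D by (intro eq_matI) (auto simp: char_poly_matrix_def one_poly_def)
  then show ?thesis
    unfolding char_poly_def using A C D
    by (simp, intro det_four_block_mat_upper_right_zero[of _ n _ m]) auto
qed

lemma char_poly_nonzero:
  fixes A :: "'a::field mat"
  assumes "A \<in> carrier_mat n n"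
  shows "char_poly A \<noteq> 0"
  using degree_monic_char_poly[OF assms] by auto

lemma triangularizable_imp_char_poly_splits:
  assumes "triangularizable A"
  shows "poly_splits (char_poly A)"
proof -
  obtain B where B: "similar_mat A B" "upper_triangular B"
    using assms unfolding triangularizable_def by blast
  obtain n where "B \<in> carrier_mat n n" using similar_matD[OF B(1)] by auto
  from char_poly_upper_triangular[OF this B(2)] char_poly_similar[OF B(1)]
  have "char_poly A = Polynomial.smult 1 (\<Prod>a\<leftarrow>diag_mat B. [:-a, 1:])" by simp
  then show ?thesis unfolding poly_splits_def by blast
qed

text \<open>
  The classical comparison of \<open>X \<Phi>\<close> with \<open>\<Phi> X\<close>: conjugation by a unipotent block matrix carries
  \<open>(X \<Phi>, 0; \<Phi>, 0)\<close> to \<open>(0, 0; \<Phi>, \<Phi> X)\<close>, so the two characteristic polynomials agree up to powers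
  of \<open>t\<close>. It reduces combinations of few rank-one matrices to small Gram matrices.
\<close>
lemma char_poly_product_splits_swap:
  fixes X \<Phi> :: "'a::field mat"
  assumes X: "X \<in> carrier_mat n k" and P: "\<Phi> \<in> carrier_mat k n"
    and s: "poly_splits (char_poly (X * \<Phi>))"
  shows "poly_splits (char_poly (\<Phi> * X))"
proof -
  let ?M = "four_block_mat (X * \<Phi>) (0\<^sub>m n k) \<Phi> (0\<^sub>m k k)"
  let ?N = "four_block_mat (0\<^sub>m n n) (0\<^sub>m n k) \<Phi> (\<Phi> * X)"
  let ?P = "four_block_mat (1\<^sub>m n) X (0\<^sub>m k n) (1\<^sub>m k)"
  let ?Q = "four_block_mat (1\<^sub>m n) (- X) (0\<^sub>m k n) (1\<^sub>m k)"
  note [simp] = X P carrier_matD[OF X] carrier_matD[OF P]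
  have XP: "X * \<Phi> \<in> carrier_mat n n" "\<Phi> * X \<in> carrier_mat k k"
    by (rule mult_carrier_mat[OF X P], rule mult_carrier_mat[OF P X])
  have z: "- X + X = 0\<^sub>m n k" "X + - X = 0\<^sub>m n k"
    "- 0\<^sub>m k k + 1\<^sub>m k = (1\<^sub>m k :: 'a mat)" "1\<^sub>m k + - 0\<^sub>m k k = (1\<^sub>m k :: 'a mat)"
    by (auto intro!: eq_matI)
  have PQ: "?P * ?Q = 1\<^sub>m (n + k)"
    by (subst mult_four_block_mat[of _ n n _ k _ k]) (auto simp: z)
  have QP: "?Q * ?P = 1\<^sub>m (n + k)"
    by (subst mult_four_block_mat[of _ n n _ k _ k]) (auto simp: z)
  have "?P * ?N = four_block_mat (X * \<Phi>) (X * (\<Phi> * X)) \<Phi> (\<Phi> * X)"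
    by (subst mult_four_block_mat[of _ n n _ k _ k]) auto
  also have "\<dots> * ?Q = four_block_mat (X * \<Phi>) (X * \<Phi> * (- X) + X * (\<Phi> * X)) \<Phi> (\<Phi> * (- X) + \<Phi> * X)"
    by (subst mult_four_block_mat[of _ n n _ k _ k]) (auto simp: XP)
  also have "\<Phi> * (- X) + \<Phi> * X = 0\<^sub>m k k"
    using uminus_l_inv_mat[OF XP(2)] by simp
  also have "X * \<Phi> * (- X) + X * (\<Phi> * X) = 0\<^sub>m n k"
    using uminus_l_inv_mat[OF mult_carrier_mat[OF X XP(2)]] assoc_mult_mat[OF X P X] by simp
  finally have "?M = ?P * ?N * ?Q" by simp
  then have "similar_mat ?M ?N"
    by (intro similar_matI[OF _ PQ QP]) auto
  then have "char_poly ?M = char_poly ?N" by (rule char_poly_similar)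
  then have e: "char_poly (X * \<Phi>) * char_poly (0\<^sub>m k k) = char_poly (0\<^sub>m n n) * char_poly (\<Phi> * X)"
    by (subst (asm) (1 2) char_poly_four_block_upper_right_zero) auto
  have "upper_triangular (0\<^sub>m k k :: 'a mat)" by auto
  then have "char_poly (0\<^sub>m k k :: 'a mat) = Polynomial.smult 1 (\<Prod>a\<leftarrow>diag_mat (0\<^sub>m k k). [:-a, 1:])"
    using char_poly_upper_triangular[of "0\<^sub>m k k :: 'a mat" k] by simp
  then have "poly_splits (char_poly (0\<^sub>m k k :: 'a mat))" unfolding poly_splits_def by blast
  from poly_splits_mult[OF s this] have "poly_splits (char_poly (0\<^sub>m n n) * char_poly (\<Phi> * X))"
    by (simp add: e)
  then show ?thesis
    by (rule poly_splits_mult_imp_right) (use char_poly_nonzero[OF XP(2)] char_poly_nonzero[of "0\<^sub>m n n" n] in auto)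
qed

lemma det_mat_2:
  assumes "A \<in> carrier_mat 2 2"
  shows "det A = A $$ (0,0) * A $$ (1,1) - A $$ (0,1) * A $$ (1,0)"
  using assms
  by (subst laplace_expansion_column[of _ 2 0]) 
     (auto simp: numeral_2_eq_2 cofactor_def mat_delete_def det_single lessThan_Suc algebra_simps)

lemma det_mat_3:
  assumes "A \<in> carrier_mat 3 3"
  shows "det A = A $$ (0,0) * (A $$ (1,1) * A $$ (2,2) - A $$ (1,2) * A $$ (2,1))
     - A $$ (1,0) * (A $$ (0,1) * A $$ (2,2) - A $$ (0,2) * A $$ (2,1))
     + A $$ (2,0) * (A $$ (0,1) * A $$ (1,2) - A $$ (0,2) * A $$ (1,1))"
proof -
  have md: "mat_delete A i 0 \<in> carrier_mat 2 2" for i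
    using assms by (auto simp: mat_delete_def)
  have "det A = (\<Sum>i<3. A $$ (i,0) * cofactor A i 0)"
    using laplace_expansion_column[OF assms, of 0] by simp
  also have "\<dots> = A $$ (0,0) * cofactor A 0 0 + A $$ (1,0) * cofactor A 1 0 + A $$ (2,0) * cofactor A 2 0"
    by (simp add: numeral_3_eq_3 lessThan_Suc numeral_2_eq_2 add_ac)
  finally show ?thesis
    using assms by (simp add: cofactor_def det_mat_2[OF md]) (simp add: mat_delete_def numeral_2_eq_2 algebra_simps)
qed

section \<open>Dimension of spaces of matrices\<close>

text \<open>
  The closure properties alone, without the module records of the ambient structure.
\<close>
definition matrix_subspace :: "nat \<Rightarrow> 'a::field mat set \<Rightarrow> bool" where
  "matrix_subspace n W \<longleftrightarrow> W \<subseteq> carrier_mat n n \<and> 0\<^sub>m n n \<in> W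
     \<and> (\<forall>A\<in>W. \<forall>B\<in>W. A + B \<in> W) \<and> (\<forall>c. \<forall>A\<in>W. c \<cdot>\<^sub>m A \<in> W)"

lemma matrix_subspace_iff:
  "VectorSpace.subspace class_ring W (module_mat TYPE('a::field) n n) \<longleftrightarrow> matrix_subspace n W"
proof -
  interpret M: vectorspace "class_ring :: 'a ring" "module_mat TYPE('a) n n" by (rule matrix_vs)
  show ?thesis
    unfolding VectorSpace.subspace_def submodule_def matrix_subspace_def
    by (auto simp: matrix_vs_simps M.vectorspace_axioms M.module_axioms)
qed

text \<open>
  Finite dimension of the domain is part of the conclusion: images of independent finite sets are
  independent, which bounds their size, so a maximal independent set exists and is a finite basis.
\<close>
lemma (in linear_map) inj_imp_dim_le:
  assumes inj: "inj_on T (carrier V)" and fin: "W.fin_dim"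
  shows "V.fin_dim \<and> V.dim \<le> W.dim"
proof -
  have fin_le: "card S \<le> W.dim" if S: "S \<subseteq> carrier V" "V.module.lin_indpt S" "finite S" for S
  proof -
    have "W.module.lin_indpt (T ` S)"
    proof (rule W.module.finite_lin_indpt2)
      show "finite (T ` S)" "T ` S \<subseteq> carrier W" using S by auto
      fix a assume a: "a \<in> T ` S \<rightarrow> carrier K" and 0: "W.module.lincomb a (T ` S) = \<zero>\<^bsub>W\<^esub>"
      have aT: "a \<circ> T \<in> S \<rightarrow> carrier K" using a by auto
      have "T (V.module.lincomb (a \<circ> T) S) = \<zero>\<^bsub>W\<^esub>"
        using lincomb_linear_image[OF inj S(1) a S(3)] 0 by simp
      then have "V.module.lincomb (a \<circ> T) S = \<zero>\<^bsub>V\<^esub>"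
        using inj_onD[OF inj, of _ "\<zero>\<^bsub>V\<^esub>"] V.module.lincomb_closed[OF S(1) aT] by simp
      then have "a \<circ> T \<in> S \<rightarrow> {\<zero>\<^bsub>K\<^esub>}"
        using V.not_lindepD[OF S(2) S(3) subset_refl aT] by simp
      then show "\<forall>v\<in>T ` S. a v = \<zero>\<^bsub>K\<^esub>" by auto
    qed
    then have "card (T ` S) \<le> W.dim" using W.li_le_dim(2)[OF fin, of "T ` S"] S(1) by auto
    moreover have "card (T ` S) = card S" using inj S(1) by (meson card_image inj_on_subset)
    ultimately show ?thesis by simp
  qed
  have bound: "finite S \<and> card S \<le> W.dim" if "S \<subseteq> carrier V \<and> V.module.lin_indpt S" for S
  proof (cases "finite S")
    case False
    then obtain B where B: "B \<subseteq> S" "finite B" "card B = W.dim + 1"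
      by (metis infinite_arbitrarily_large)
    have "V.module.lin_indpt B" using V.module.subset_li_is_li[of S B] that B(1) by auto
    then show ?thesis using fin_le[of B] that B by auto
  qed (use fin_le that in auto)
  have "V.module.lin_indpt {}" by (rule V.module.finite_lin_indpt2) auto
  then obtain S where S: "finite S" "maximal S (\<lambda>S. S \<subseteq> carrier V \<and> V.module.lin_indpt S)"
    using maximal_exists[of "\<lambda>S. S \<subseteq> carrier V \<and> V.module.lin_indpt S", OF bound] by auto
  have b: "V.basis S" by (rule V.max_li_is_basis[OF S(2)])
  then have "V.fin_dim" unfolding V.fin_dim_def V.basis_def using S(1) by auto
  moreover have "V.dim = card S" by (rule V.dim_basis[OF S(1) b])
  moreover have "card S \<le> W.dim" using bound S(2) unfolding maximal_def by auto
  ultimately show ?thesis by simp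
qed

definition matrix_form :: "nat \<Rightarrow> ('a::field mat \<Rightarrow> 'a) \<Rightarrow> bool" where
  "matrix_form n f \<longleftrightarrow> (\<forall>A\<in>carrier_mat n n. \<forall>B\<in>carrier_mat n n. f (A + B) = f A + f B)
     \<and> (\<forall>c. \<forall>A\<in>carrier_mat n n. f (c \<cdot>\<^sub>m A) = c * f A)"

text \<open>
  An upper bound \<open>d\<close> for the dimension of \<open>W\<close>, expressed by \<open>d\<close> linear forms of the ambient space without
  a common nonzero zero on \<open>W\<close>. In this form bounds are additive: the forms that cut out a subspace can be
  followed by forms pulled back from an image on which that subspace is represented faithfully.
\<close>
definition separated_by_forms :: "nat \<Rightarrow> 'a::field mat set \<Rightarrow> nat \<Rightarrow> bool" where
  "separated_by_forms n W d \<longleftrightarrow> (\<exists>fs. length fs = d \<and> (\<forall>f\<in>set fs. matrix_form n f)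
     \<and> (\<forall>A\<in>W. (\<forall>f\<in>set fs. f A = 0) \<longrightarrow> A = 0\<^sub>m n n))"

lemma forms_linear_map:
  assumes W: "matrix_subspace n W" and fs: "\<forall>f\<in>set fs. matrix_form n (f :: 'a::field mat \<Rightarrow> 'a)"
    and sep: "\<And>A. A \<in> W \<Longrightarrow> \<forall>f\<in>set fs. f A = 0 \<Longrightarrow> A = 0\<^sub>m n n"
  defines "T \<equiv> \<lambda>A. vec (length fs) (\<lambda>i. (fs ! i) A)"
  shows "linear_map class_ring ((module_mat TYPE('a) n n)\<lparr>carrier := W\<rparr>) (module_vec TYPE('a) (length fs)) T"
    and "inj_on T W"
proof -
  let ?V = "(module_mat TYPE('a) n n)\<lparr>carrier := W\<rparr>"
  interpret M: vectorspace "class_ring :: 'a ring" "module_mat TYPE('a) n n" by (rule matrix_vs)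
  interpret V: vectorspace "class_ring :: 'a ring" ?V
    by (rule M.subspace_is_vs) (simp add: matrix_subspace_iff W)
  interpret U: vectorspace "class_ring :: 'a ring" "module_vec TYPE('a) (length fs)" by (rule vec_vs)
  have WC: "A \<in> carrier_mat n n" if "A \<in> W" for A using W that by (auto simp: matrix_subspace_def)
  have add: "T (A + B) = T A + T B" if "A \<in> W" "B \<in> W" for A B
    using fs that WC by (intro eq_vecI) (auto simp: T_def matrix_form_def)
  have sm: "T (c \<cdot>\<^sub>m A) = c \<cdot>\<^sub>v T A" if "A \<in> W" for A c
    using fs that WC by (intro eq_vecI) (auto simp: T_def matrix_form_def)
  show "linear_map class_ring ?V (module_vec TYPE('a) (length fs)) T"
  proof (intro linear_map.intro mod_hom.intro mod_hom_axioms.intro)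
    have "T A \<in> carrier_vec (length fs)" for A by (simp add: T_def)
    then show "T \<in> LinearCombinations.module_hom class_ring ?V (module_vec TYPE('a) (length fs))"
      using add sm by (simp add: LinearCombinations.module_hom_def module_mat_simps module_vec_simps)
  qed (rule V.vectorspace_axioms U.vectorspace_axioms V.module_axioms U.module_axioms)+
  show "inj_on T W"
  proof (rule inj_onI)
    fix A B assume AB: "A \<in> W" "B \<in> W" "T A = T B"
    have mB: "(-1) \<cdot>\<^sub>m B \<in> W" using W AB by (auto simp: matrix_subspace_def)
    then have D: "A + (-1) \<cdot>\<^sub>m B \<in> W" using W AB by (auto simp: matrix_subspace_def)
    have "T (A + (-1) \<cdot>\<^sub>m B) = T A + (-1) \<cdot>\<^sub>v T B" using add[OF AB(1) mB] sm[OF AB(2)] by simp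
    also have "\<dots> = 0\<^sub>v (length fs)" unfolding AB(3) by (intro eq_vecI) (auto simp: T_def)
    finally have z: "T (A + (-1) \<cdot>\<^sub>m B) = 0\<^sub>v (length fs)" .
    have "(fs ! i) (A + (-1) \<cdot>\<^sub>m B) = 0" if "i < length fs" for i
      using arg_cong[OF z, of "\<lambda>v. v $ i"] that by (simp add: T_def)
    then have "A + (-1) \<cdot>\<^sub>m B = 0\<^sub>m n n"
      by (intro sep[OF D]) (auto simp: in_set_conv_nth)
    then have z: "(A + (-1) \<cdot>\<^sub>m B) $$ (i,j) = 0" if "i < n" "j < n" for i j
      using that by simp
    have e: "A $$ (i,j) + - B $$ (i,j) = 0" if "i < n" "j < n" for i j
      using z[OF that] that carrier_matD[OF WC[OF AB(1)]] carrier_matD[OF WC[OF AB(2)]] by simp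
    show "A = B"
      using WC[OF AB(1)] WC[OF AB(2)] e by (intro eq_matI) auto
  qed
qed

lemma mat_subspace_dim_le:
  assumes W: "matrix_subspace n W" and sep: "separated_by_forms n W d"
  shows "mat_subspace_dim n W \<le> d"
proof -
  obtain fs where fs: "length fs = d" "\<forall>f\<in>set fs. matrix_form n f"
    "\<And>A. A \<in> W \<Longrightarrow> \<forall>f\<in>set fs. f A = 0 \<Longrightarrow> A = 0\<^sub>m n n"
    using sep unfolding separated_by_forms_def by blast
  note lm = forms_linear_map[OF W fs(2,3)]
  interpret U: vec_space "TYPE('a)" "length fs" .
  have "vectorspace.dim class_ring ((module_mat TYPE('a) n n)\<lparr>carrier := W\<rparr>) \<le> U.dim"
    using linear_map.inj_imp_dim_le[OF lm(1)] lm(2) U.fin_dim by auto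
  then show ?thesis unfolding mat_subspace_dim_def using fs(1) U.dim_is_n by simp
qed

definition coordinate_subspace :: "nat \<Rightarrow> (nat \<times> nat) set \<Rightarrow> 'a::field mat set" where
  "coordinate_subspace n I = {A \<in> carrier_mat n n. \<forall>i<n. \<forall>j<n. (i, j) \<notin> I \<longrightarrow> A $$ (i, j) = 0}"

lemma matrix_subspace_coordinate: "matrix_subspace n (coordinate_subspace n I)"
  by (auto simp: matrix_subspace_def coordinate_subspace_def)

lemma matrix_form_entry: "i < n \<Longrightarrow> j < n \<Longrightarrow> matrix_form n (\<lambda>A. A $$ (i, j))"
  by (auto simp: matrix_form_def)

lemma mat_subspace_dim_coordinate:
  assumes I: "I \<subseteq> {..<n} \<times> {..<n}"
  shows "mat_subspace_dim n (coordinate_subspace n I :: 'a::field mat set) = card I"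
proof -
  have "finite I" using I finite_subset by blast
  then obtain ps where ps: "set ps = I" "distinct ps" using finite_distinct_list by blast
  let ?W = "coordinate_subspace n I :: 'a mat set"
  define fs :: "('a mat \<Rightarrow> 'a) list" where "fs = map (\<lambda>p A. A $$ p) ps"
  have W: "matrix_subspace n ?W" by (rule matrix_subspace_coordinate)
  have 1: "\<forall>f\<in>set fs. matrix_form n f"
    using I ps by (auto simp: fs_def intro!: matrix_form_entry)
  have 2: "A = 0\<^sub>m n n" if "A \<in> ?W" "\<forall>f\<in>set fs. f A = 0" for A
    using that ps by (intro eq_matI) (auto simp: fs_def coordinate_subspace_def)
  note lm = forms_linear_map[OF W 1 2]
  interpret U: vec_space "TYPE('a)" "length fs" .
  let ?T = "\<lambda>A. vec (length fs) (\<lambda>i. (fs ! i) A)"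
  have "?T ` ?W = carrier_vec (length fs)"
  proof (intro equalityI subsetI)
    fix v :: "'a vec" assume v: "v \<in> carrier_vec (length fs)"
    define A where "A = mat n n (\<lambda>p. if p \<in> I then v $ (THE k. k < length ps \<and> ps ! k = p) else 0)"
    have the: "(THE k. k < length ps \<and> ps ! k = ps ! i) = i" if "i < length ps" for i
      using that ps(2) by (intro the_equality) (auto simp: nth_eq_iff_index_eq)
    have "A \<in> ?W" by (auto simp: A_def coordinate_subspace_def)
    moreover have "?T A = v"
    proof (rule eq_vecI)
      fix i assume "i < dim_vec v"
      then have i: "i < length ps" using v by (simp add: fs_def)
      then have "ps ! i \<in> I" using ps by auto
      then show "?T A $ i = v $ i" using i I the[OF i] by (auto simp: fs_def A_def)
    qed (use v in simp)
    ultimately show "v \<in> ?T ` ?W" by blast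
  qed auto
  then have "vectorspace.dim class_ring ((module_mat TYPE('a) n n)\<lparr>carrier := ?W\<rparr>) = U.dim"
    using linear_map.dim_eq[OF lm(1)] linear_map.inj_imp_dim_le[OF lm(1)] lm(2) U.fin_dim by auto
  then show ?thesis
    unfolding mat_subspace_dim_def using U.dim_is_n distinct_card[OF ps(2)] ps(1) by (simp add: fs_def)
qed

section \<open>Invariant subspaces and diagonal blocks\<close>

text \<open>
  The columns of \<open>X\<close> span a subspace \<open>U\<close>; \<open>B'\<close> inverts the top block of \<open>X\<close>, so \<open>X\<close> completes to the
  invertible matrix \<open>Q = (B, 0; C, 1)\<close> and conjugation by \<open>Q\<close> moves \<open>U\<close> to the first \<open>k\<close> coordinates.
  There the forms are the \<open>m k\<close> entries of the lower left block, whose vanishing says that \<open>U\<close> is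
  invariant, and the forms that the two hypotheses supply for the diagonal blocks. An element on which all
  of them vanish lives in the upper right block, that is, it factors as \<open>X L\<close> with \<open>L X = 0\<close>.
\<close>
lemma separating_block:
  fixes V :: "'a::field mat set"
  assumes V: "matrix_subspace (k + m) V" and split: "\<And>A. A \<in> V \<Longrightarrow> poly_splits (char_poly A)"
    and IHk: "\<And>W :: 'a mat set. matrix_subspace k W \<Longrightarrow> \<forall>A\<in>W. poly_splits (char_poly A) \<Longrightarrow> separated_by_forms k W d"
    and IHm: "\<And>W :: 'a mat set. matrix_subspace m W \<Longrightarrow> \<forall>A\<in>W. poly_splits (char_poly A) \<Longrightarrow> separated_by_forms m W e"
    and X: "X \<in> carrier_mat (k + m) k"
    and B': "B' \<in> carrier_mat k k" "B' * mat k k (\<lambda>p. X $$ p) = 1\<^sub>m k"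
    and nonsep: "\<not> separated_by_forms (k + m) V (m * k + d + e)"
  shows "\<exists>L\<in>carrier_mat k (k + m). L * X = 0\<^sub>m k k \<and> X * L \<in> V \<and> X * L \<noteq> 0\<^sub>m (k + m) (k + m)"
proof (rule ccontr)
  assume neg: "\<not> ?thesis"
  let ?n = "k + m"
  define B where "B = mat k k (\<lambda>p. X $$ p)"
  define C where "C = mat m k (\<lambda>(i,j). X $$ (i + k, j))"
  define Q where "Q = four_block_mat B (0\<^sub>m k m) C (1\<^sub>m m)"
  define P where "P = four_block_mat B' (0\<^sub>m k m) (- (C * B')) (1\<^sub>m m)"
  have Bc: "B \<in> carrier_mat k k" and Cc: "C \<in> carrier_mat m k" by (auto simp: B_def C_def)
  note [simp] = Bc Cc B'(1) carrier_matD[OF Bc] carrier_matD[OF Cc] carrier_matD[OF B'(1)]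
  have B'B: "B' * B = 1\<^sub>m k" using B' by (simp add: B_def)
  have Qc: "Q \<in> carrier_mat ?n ?n" and Pc: "P \<in> carrier_mat ?n ?n" by (auto simp: Q_def P_def)
  have "- (C * B') * B + C = 0\<^sub>m m k"
  proof -
    have "C * B' * B = C" using assoc_mult_mat[OF Cc B'(1) Bc] B'B by simp
    then have "- (C * B') * B = - C" by simp
    then show ?thesis using uminus_l_inv_mat[OF Cc] by simp
  qed
  then have PQ: "P * Q = 1\<^sub>m ?n"
    unfolding P_def Q_def by (subst mult_four_block_mat[of _ k k _ m _ m]) (auto simp: B'B)
  then have QP: "Q * P = 1\<^sub>m ?n" using mat_mult_left_right_inverse[OF Pc Qc] by simp
  define T where "T A = P * A * Q" for A
  have Vc: "A \<in> carrier_mat ?n ?n" if "A \<in> V" for A using that V by (auto simp: matrix_subspace_def)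
  have Tc: "T A \<in> carrier_mat ?n ?n" if "A \<in> carrier_mat ?n ?n" for A
    using that Pc Qc by (auto simp: T_def)
  have T_add: "T (A + A') = T A + T A'" if "A \<in> carrier_mat ?n ?n" "A' \<in> carrier_mat ?n ?n" for A A'
    unfolding T_def using that Pc Qc
    by (simp add: mult_add_distrib_mat[of _ ?n ?n] add_mult_distrib_mat[of _ ?n ?n _ _ ?n])
  have T_smult: "T (c \<cdot>\<^sub>m A) = c \<cdot>\<^sub>m T A" if "A \<in> carrier_mat ?n ?n" for A c
    unfolding T_def using that Pc Qc
    by (simp add: mult_smult_distrib[of _ ?n ?n] mult_smult_assoc_mat[of _ ?n ?n _ ?n])
  have T_inv: "Q * T A * P = A" if A: "A \<in> carrier_mat ?n ?n" for A
  proof -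
    have "Q * (P * A * Q) * P = (Q * P) * A * (Q * P)"
      using A Pc Qc by (simp add: assoc_mult_mat[of _ ?n ?n _ ?n _ ?n])
    then show ?thesis using A by (simp add: T_def QP)
  qed
  have T_similar: "similar_mat A (T A)" if "A \<in> carrier_mat ?n ?n" for A
    using T_inv[OF that] Tc[OF that] that Pc Qc by (intro similar_matI[OF _ QP PQ]) auto
  define b1 where "b1 M = mat k k (\<lambda>p. M $$ p)" for M :: "'a mat"
  define b2 where "b2 M = mat k m (\<lambda>(i,j). M $$ (i, j + k))" for M :: "'a mat"
  define b4 where "b4 M = mat m m (\<lambda>(i,j). M $$ (i + k, j + k))" for M :: "'a mat"
  \<comment> \<open>the elements of \<open>V\<close> that leave the span \<open>U\<close> of the columns of \<open>X\<close> invariant\<close>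
  define V0 where "V0 = {A \<in> V. \<forall>i<m. \<forall>j<k. T A $$ (i + k, j) = 0}"
  have V0V: "A \<in> V" if "A \<in> V0" for A using that by (simp add: V0_def)
  have V0_block: "T A = four_block_mat (b1 (T A)) (b2 (T A)) (0\<^sub>m m k) (b4 (T A))" if A: "A \<in> V0" for A
  proof (rule eq_matI)
    fix i j assume ij: "i < dim_row (four_block_mat (b1 (T A)) (b2 (T A)) (0\<^sub>m m k) (b4 (T A)))"
      "j < dim_col (four_block_mat (b1 (T A)) (b2 (T A)) (0\<^sub>m m k) (b4 (T A)))"
    have "T A $$ (i, j) = 0" if "\<not> i < k" "j < k"
    proof -
      have "i - k < m" using that ij by (auto simp: b1_def b2_def b4_def)
      then have "T A $$ (i - k + k, j) = 0" using A that unfolding V0_def by blast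
      then show ?thesis using that by simp
    qed
    then show "T A $$ (i, j) = four_block_mat (b1 (T A)) (b2 (T A)) (0\<^sub>m m k) (b4 (T A)) $$ (i, j)"
      using ij by (auto simp: b1_def b2_def b4_def)
  qed (use Tc[OF Vc[OF V0V[OF A]]] in \<open>auto simp: b1_def b2_def b4_def\<close>)
  have V0_splits: "poly_splits (char_poly (b1 (T A))) \<and> poly_splits (char_poly (b4 (T A)))" if A: "A \<in> V0" for A
  proof -
    have c: "b1 (T A) \<in> carrier_mat k k" "b2 (T A) \<in> carrier_mat k m" "b4 (T A) \<in> carrier_mat m m"
      by (auto simp: b1_def b2_def b4_def)
    have "char_poly A = char_poly (b1 (T A)) * char_poly (b4 (T A))"
      using char_poly_similar[OF T_similar[OF Vc[OF V0V[OF A]]]] V0_block[OF A]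
        char_poly_four_block_lower_left_zero[OF c] by simp
    then have "poly_splits (char_poly (b1 (T A)) * char_poly (b4 (T A)))"
      using split[OF V0V[OF A]] by simp
    moreover have "char_poly (b1 (T A)) * char_poly (b4 (T A)) \<noteq> 0"
      using char_poly_nonzero[OF c(1)] char_poly_nonzero[OF c(3)] by simp
    ultimately show ?thesis
      by (metis poly_splits_mult_imp_right mult.commute)
  qed
  have V0: "0\<^sub>m ?n ?n \<in> V0" "\<And>A A'. A \<in> V0 \<Longrightarrow> A' \<in> V0 \<Longrightarrow> A + A' \<in> V0" "\<And>c A. A \<in> V0 \<Longrightarrow> c \<cdot>\<^sub>m A \<in> V0"
  proof -
    have "T (0\<^sub>m ?n ?n) = 0\<^sub>m ?n ?n" using Pc Qc by (simp add: T_def)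
    then show "0\<^sub>m ?n ?n \<in> V0" using V by (auto simp: V0_def matrix_subspace_def)
    show "A + A' \<in> V0" if "A \<in> V0" "A' \<in> V0" for A A'
      using that V T_add[OF Vc[OF V0V] Vc[OF V0V], OF that]
        carrier_matD[OF Tc[OF Vc[OF V0V[OF that(1)]]]] carrier_matD[OF Tc[OF Vc[OF V0V[OF that(2)]]]]
      by (auto simp: V0_def matrix_subspace_def)
    show "c \<cdot>\<^sub>m A \<in> V0" if "A \<in> V0" for A c
      using that V T_smult[OF Vc[OF V0V], OF that] carrier_matD[OF Tc[OF Vc[OF V0V[OF that]]]]
      by (auto simp: V0_def matrix_subspace_def)
  qed
  have image_subspace: "matrix_subspace l ((\<lambda>A. g (T A)) ` V0)"
    if "\<And>M. g M \<in> carrier_mat l l" "g (0\<^sub>m ?n ?n) = 0\<^sub>m l l"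
      "\<And>M N. M \<in> carrier_mat ?n ?n \<Longrightarrow> N \<in> carrier_mat ?n ?n \<Longrightarrow> g (M + N) = g M + g N"
      "\<And>c M. M \<in> carrier_mat ?n ?n \<Longrightarrow> g (c \<cdot>\<^sub>m M) = c \<cdot>\<^sub>m g M" for l and g :: "'a mat \<Rightarrow> 'a mat"
    unfolding matrix_subspace_def
  proof (intro conjI ballI allI)
    show "(\<lambda>A. g (T A)) ` V0 \<subseteq> carrier_mat l l" using that(1) by auto
    have "T (0\<^sub>m ?n ?n) = 0\<^sub>m ?n ?n" using Pc Qc by (simp add: T_def)
    then show "0\<^sub>m l l \<in> (\<lambda>A. g (T A)) ` V0" using V0(1) that(2) by (metis image_eqI)
    fix M assume "M \<in> (\<lambda>A. g (T A)) ` V0"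
    then obtain A where A: "A \<in> V0" "M = g (T A)" by blast
    have Ac: "A \<in> carrier_mat ?n ?n" using A V0V Vc by blast
    show "c \<cdot>\<^sub>m M \<in> (\<lambda>A. g (T A)) ` V0" for c
      using V0(3)[OF A(1), of c] T_smult[OF Ac] that(4)[OF Tc[OF Ac]] A(2) by (metis image_eqI)
    fix N assume "N \<in> (\<lambda>A. g (T A)) ` V0"
    then obtain A' where A': "A' \<in> V0" "N = g (T A')" by blast
    have Ac': "A' \<in> carrier_mat ?n ?n" using A' V0V Vc by blast
    show "M + N \<in> (\<lambda>A. g (T A)) ` V0"
      using V0(2)[OF A(1) A'(1)] T_add[OF Ac Ac'] that(3)[OF Tc[OF Ac] Tc[OF Ac']] A(2) A'(2)
      by (metis image_eqI)
  qed
  have "separated_by_forms k ((\<lambda>A. b1 (T A)) ` V0) d"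
    by (intro IHk image_subspace) (use V0_splits in \<open>auto simp: b1_def\<close>)
  then obtain fs1 where fs1: "length fs1 = d" "\<forall>f\<in>set fs1. matrix_form k f"
    "\<forall>M\<in>(\<lambda>A. b1 (T A)) ` V0. (\<forall>f\<in>set fs1. f M = 0) \<longrightarrow> M = 0\<^sub>m k k"
    unfolding separated_by_forms_def by blast
  have "separated_by_forms m ((\<lambda>A. b4 (T A)) ` V0) e"
    by (intro IHm image_subspace) (use V0_splits in \<open>auto simp: b4_def\<close>)
  then obtain fs4 where fs4: "length fs4 = e" "\<forall>f\<in>set fs4. matrix_form m f"
    "\<forall>M\<in>(\<lambda>A. b4 (T A)) ` V0. (\<forall>f\<in>set fs4. f M = 0) \<longrightarrow> M = 0\<^sub>m m m"
    unfolding separated_by_forms_def by blast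
  define fs3 where "fs3 = map (\<lambda>p A. T A $$ (fst p + k, snd p)) (List.product [0..<m] [0..<k])"
  define fs where "fs = fs3 @ map (\<lambda>f A. f (b1 (T A))) fs1 @ map (\<lambda>f A. f (b4 (T A))) fs4"
  have "length fs = m * k + d + e" by (simp add: fs_def fs3_def fs1 fs4)
  moreover have "\<forall>f\<in>set fs. matrix_form ?n f"
  proof -
    have b1_lin: "b1 (M + N) = b1 M + b1 N" "b1 (c \<cdot>\<^sub>m M) = c \<cdot>\<^sub>m b1 M"
      if "M \<in> carrier_mat ?n ?n" "N \<in> carrier_mat ?n ?n" for M N c
      using that by (auto simp: b1_def intro!: eq_matI)
    have b4_lin: "b4 (M + N) = b4 M + b4 N" "b4 (c \<cdot>\<^sub>m M) = c \<cdot>\<^sub>m b4 M"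
      if "M \<in> carrier_mat ?n ?n" "N \<in> carrier_mat ?n ?n" for M N c
      using that by (auto simp: b4_def intro!: eq_matI)
    have bc: "b1 M \<in> carrier_mat k k" "b4 M \<in> carrier_mat m m" for M by (auto simp: b1_def b4_def)
    have "matrix_form ?n (\<lambda>A. T A $$ (i + k, j))" if "i < m" "j < k" for i j
      using that T_add T_smult by (auto simp: matrix_form_def carrier_matD[OF Tc])
    moreover have "matrix_form ?n (\<lambda>A. f (b1 (T A)))" if "f \<in> set fs1" for f
      unfolding matrix_form_def
    proof (intro conjI ballI allI)
      fix A A' :: "'a mat" and c
      assume A: "A \<in> carrier_mat ?n ?n"
      show "f (b1 (T (c \<cdot>\<^sub>m A))) = c * f (b1 (T A))"
        using fs1(2) that b1_lin(2)[OF Tc[OF A] Tc[OF A]] bc T_smult[OF A] by (simp add: matrix_form_def)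
      assume A': "A' \<in> carrier_mat ?n ?n"
      show "f (b1 (T (A + A'))) = f (b1 (T A)) + f (b1 (T A'))"
        using fs1(2) that b1_lin(1)[OF Tc[OF A] Tc[OF A']] bc T_add[OF A A'] by (simp add: matrix_form_def)
    qed
    moreover have "matrix_form ?n (\<lambda>A. f (b4 (T A)))" if "f \<in> set fs4" for f
      unfolding matrix_form_def
    proof (intro conjI ballI allI)
      fix A A' :: "'a mat" and c
      assume A: "A \<in> carrier_mat ?n ?n"
      show "f (b4 (T (c \<cdot>\<^sub>m A))) = c * f (b4 (T A))"
        using fs4(2) that b4_lin(2)[OF Tc[OF A] Tc[OF A]] bc T_smult[OF A] by (simp add: matrix_form_def)
      assume A': "A' \<in> carrier_mat ?n ?n"
      show "f (b4 (T (A + A'))) = f (b4 (T A)) + f (b4 (T A'))"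
        using fs4(2) that b4_lin(1)[OF Tc[OF A] Tc[OF A']] bc T_add[OF A A'] by (simp add: matrix_form_def)
    qed
    ultimately show ?thesis unfolding fs_def fs3_def by auto
  qed
  moreover have "A = 0\<^sub>m ?n ?n" if A: "A \<in> V" and z: "\<forall>f\<in>set fs. f A = 0" for A
  proof -
    have "T A $$ (i + k, j) = 0" if "i < m" "j < k" for i j
    proof -
      have "(\<lambda>A. T A $$ (i + k, j)) \<in> set fs"
        using that unfolding fs_def fs3_def by (auto intro!: image_eqI[of _ _ "(i, j)"])
      then show ?thesis using z by auto
    qed
    then have A0: "A \<in> V0" using A by (simp add: V0_def)
    have 1: "b1 (T A) = 0\<^sub>m k k"
    proof -
      have "f (b1 (T A)) = 0" if "f \<in> set fs1" for f
      proof -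
        have "(\<lambda>A. f (b1 (T A))) \<in> set fs" using that by (auto simp: fs_def)
        then show ?thesis using z by auto
      qed
      then show ?thesis using fs1(3) A0 by blast
    qed
    have 4: "b4 (T A) = 0\<^sub>m m m"
    proof -
      have "f (b4 (T A)) = 0" if "f \<in> set fs4" for f
      proof -
        have "(\<lambda>A. f (b4 (T A))) \<in> set fs" using that by (auto simp: fs_def)
        then show ?thesis using z by auto
      qed
      then show ?thesis using fs4(3) A0 by blast
    qed
    \<comment> \<open>\<open>Q E = X\<close>, and \<open>G\<close> consists of the only nonzero rows of \<open>T A\<close>; hence
      \<open>A = Q (E G) P = X (G P)\<close>\<close>
    define E where "E = mat ?n k (\<lambda>(i,j). if i = j then 1 else (0::'a))"
    define G where "G = mat k ?n (\<lambda>p. T A $$ p)"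
    have Ec: "E \<in> carrier_mat ?n k" and Gc: "G \<in> carrier_mat k ?n" by (auto simp: E_def G_def)
    have colE: "col E j = unit_vec ?n j" if "j < k" for j
      using that by (intro eq_vecI) (auto simp: E_def unit_vec_def)
    have QE: "Q * E = X"
    proof (rule eq_matI)
      fix i j assume ij: "i < dim_row X" "j < dim_col X"
      then have "(Q * E) $$ (i, j) = row Q i \<bullet> unit_vec ?n j"
        using X Ec Qc colE by simp
      also have "\<dots> = Q $$ (i, j)" using ij X Qc by simp
      also have "\<dots> = X $$ (i, j)" using ij X by (auto simp: Q_def B_def C_def)
      finally show "(Q * E) $$ (i, j) = X $$ (i, j)" .
    qed (use X Ec Qc in auto)
    have EG: "E * G = T A"
    proof (rule eq_matI)
      fix i j assume ij: "i < dim_row (T A)" "j < dim_col (T A)"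
      then have ij': "i < ?n" "j < ?n" using Tc[OF Vc[OF A]] by auto
      show "(E * G) $$ (i, j) = T A $$ (i, j)"
      proof (cases "i < k")
        case True
        then have "row E i = unit_vec k i" by (intro eq_vecI) (auto simp: E_def unit_vec_def)
        then show ?thesis using True ij' Ec Gc by (simp add: G_def)
      next
        case False
        then have "row E i = 0\<^sub>v k" using ij' by (intro eq_vecI) (auto simp: E_def)
        then have "(E * G) $$ (i, j) = 0" using ij' Ec Gc by simp
        moreover have "T A $$ (i, j) = 0"
        proof (subst V0_block[OF A0], cases "j < k")
          case True
          then show "four_block_mat (b1 (T A)) (b2 (T A)) (0\<^sub>m m k) (b4 (T A)) $$ (i, j) = 0"
            using False ij' by (simp add: b1_def b4_def)
        next
          case jk: False
          then show "four_block_mat (b1 (T A)) (b2 (T A)) (0\<^sub>m m k) (b4 (T A)) $$ (i, j) = 0"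
            unfolding 4 using False ij' by (simp add: b1_def)
        qed
        ultimately show ?thesis by simp
      qed
    qed (use Ec Gc Tc[OF Vc[OF A]] in auto)
    have GE: "G * E = 0\<^sub>m k k"
    proof (rule eq_matI)
      fix i j assume ij: "i < dim_row (0\<^sub>m k k :: 'a mat)" "j < dim_col (0\<^sub>m k k :: 'a mat)"
      then have "(G * E) $$ (i, j) = row G i \<bullet> unit_vec ?n j"
        using Ec Gc colE by simp
      also have "\<dots> = b1 (T A) $$ (i, j)" using ij Gc by (simp add: G_def b1_def)
      finally show "(G * E) $$ (i, j) = 0\<^sub>m k k $$ (i, j)" using 1 by simp
    qed (use Ec Gc in auto)
    define L where "L = G * P"
    have Lc: "L \<in> carrier_mat k ?n" using Gc Pc by (simp add: L_def)
    have "X * L = A"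
    proof -
      have "X * L = Q * (E * G) * P"
        unfolding L_def QE[symmetric] using Qc Ec Gc Pc
        by (simp add: assoc_mult_mat[of _ ?n ?n _ k _ ?n] assoc_mult_mat[of _ ?n k _ ?n _ ?n] assoc_mult_mat[of _ ?n ?n _ ?n _ ?n])
      then show ?thesis using EG T_inv[OF Vc[OF A]] by simp
    qed
    moreover have "L * X = 0\<^sub>m k k"
    proof -
      have "L * X = G * (P * Q) * E"
        unfolding L_def QE[symmetric] using Qc Ec Gc Pc
        by (simp add: assoc_mult_mat[of _ k ?n _ ?n _ k] assoc_mult_mat[of _ ?n ?n _ ?n _ k] assoc_mult_mat[of _ k ?n _ ?n _ ?n])
      then show ?thesis using GE PQ Gc by simp
    qed
    ultimately show ?thesis using neg Lc A by blast
  qed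
  ultimately have "separated_by_forms ?n V (m * k + d + e)"
    unfolding separated_by_forms_def by blast
  then show False using nonsep by blast
qed

section \<open>Matrices with zero diagonal\<close>

lemma char_poly_2_hollow_splits:
  fixes M :: "'a::field mat"
  assumes M: "M \<in> carrier_mat 2 2" and d: "M $$ (0,0) = 0" "M $$ (1,1) = 0"
    and s: "poly_splits (char_poly M)"
  shows "\<exists>r. r\<^sup>2 = M $$ (0,1) * M $$ (1,0)"
proof -
  have cp: "char_poly M = [:- (M $$ (0,1) * M $$ (1,0)), 0, 1:]"
    unfolding char_poly_def
    by (subst det_mat_2) (use M d in \<open>auto simp: char_poly_matrix_def\<close>)
  then have "degree (char_poly M) = 2" by simp
  then obtain r where "poly (char_poly M) r = 0" using s by (subst (asm) poly_splits_quadratic_iff) auto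
  then show ?thesis unfolding cp by (intro exI[of _ r]) (simp add: power2_eq_square algebra_simps)
qed

text \<open>
  If \<open>q \<noteq> 0\<close>, then dividing a root of the resolvent by \<open>q\<close> would give a solution of
  \<open>z\<^sup>2 + z = 1 + p\<^sup>3 / q\<^sup>2 = 1 + k\<close>.
\<close>
lemma char_2_hollow_splits:
  fixes M :: "'a::field mat"
  assumes 2: "(2::'a) = 0" and k: "\<And>z::'a. z\<^sup>2 + z \<noteq> 1 + k"
    and M: "M \<in> carrier_mat 3 3" and d: "M $$ (0,0) = 0" "M $$ (1,1) = 0" "M $$ (2,2) = 0"
    and s: "poly_splits (char_poly M)"
    and p: "p = M $$ (0,1) * M $$ (1,0) + M $$ (0,2) * M $$ (2,0) + M $$ (1,2) * M $$ (2,1)"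
    and q: "q = M $$ (0,1) * M $$ (1,2) * M $$ (2,0) + M $$ (0,2) * M $$ (2,1) * M $$ (1,0)"
    and eq: "p ^ 3 = k * q\<^sup>2"
  shows "q = 0"
proof (rule ccontr)
  assume q0: "q \<noteq> 0"
  have neg: "- x = x" for x :: 'a using 2 by (metis add_eq_0_iff mult_2 mult_zero_left)
  have cp: "char_poly M = [:- q, - p, 0, 1:]"
    unfolding char_poly_def
    by (subst det_mat_3) (use M d in \<open>auto simp: char_poly_matrix_def p q algebra_simps numeral_2_eq_2\<close>)
  obtain r t u where "char_poly M = [:-r, 1:] * [:-t, 1:] * [:-u, 1:]"
    using poly_splits_monic_cubic[OF s] unfolding cp by (auto simp: numeral_3_eq_3)
  then have "[:- q, - p, 0, 1:] = [:- (r * t * u), r * t + t * u + u * r, - (r + t + u), 1:]"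
    unfolding cp by (simp add: algebra_simps)
  then have e: "q = r * t * u" "- p = r * t + t * u + u * r" "r + t + u = 0"
    by (auto simp: add_eq_0_iff)
  from char_2_cubic_resolvent[OF 2 e(3)] obtain z where "z\<^sup>2 + q * z + p ^ 3 + q\<^sup>2 = 0"
    unfolding e(1)[symmetric] e(2)[symmetric] neg by blast
  then have "z\<^sup>2 + q * z = - ((k + 1) * q\<^sup>2)" unfolding eq by (simp add: add_eq_0_iff2 algebra_simps)
  then have "z\<^sup>2 + q * z = (1 + k) * q\<^sup>2" unfolding neg by (simp add: add.commute)
  then have "(z / q)\<^sup>2 + z / q = 1 + k" using q0 by (simp add: power2_eq_square field_simps)
  then show False using k by blast
qed

section \<open>Sums of rank-one matrices\<close>

definition outer :: "nat \<Rightarrow> 'a::field vec list \<Rightarrow> 'a vec list \<Rightarrow> 'a mat" where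
  "outer n xs \<phi>s = mat n n (\<lambda>(i, j). \<Sum>l<length xs. xs ! l $ i * \<phi>s ! l $ j)"

lemma outer_eq_mult:
  assumes "length xs = length \<phi>s"
  shows "outer n xs \<phi>s = mat_of_cols n xs * mat_of_rows n \<phi>s"
  using assms
  by (intro eq_matI) (auto simp: outer_def scalar_prod_def mat_of_cols_index mat_of_rows_index lessThan_atLeast0 intro!: sum.cong)

lemma outer_smult:
  assumes "\<phi> \<in> carrier_vec n"
  shows "outer n [x] [c \<cdot>\<^sub>v \<phi>] = c \<cdot>\<^sub>m outer n [x] [\<phi>]"
  using assms by (intro eq_matI) (auto simp: outer_def algebra_simps)

lemma outer_Cons: "outer n (x # xs) (\<phi> # \<phi>s) = outer n [x] [\<phi>] + outer n xs \<phi>s"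
  by (intro eq_matI) (auto simp: outer_def sum.lessThan_Suc_shift simp del: sum.lessThan_Suc)

lemma outer_mem:
  assumes V: "matrix_subspace n V" and l: "list_all2 (\<lambda>x \<phi>. outer n [x] [\<phi>] \<in> V) xs \<phi>s"
  shows "outer n xs \<phi>s \<in> V"
  using l
proof (induction rule: list_all2_induct)
  case Nil
  have "outer n [] [] = (0\<^sub>m n n :: 'a mat)" by (intro eq_matI) (auto simp: outer_def)
  then show ?case using V by (simp add: matrix_subspace_def)
next
  case (Cons x xs \<phi> \<phi>s)
  then show ?case using V by (subst outer_Cons) (auto simp: matrix_subspace_def)
qed

lemma gram_splits:
  fixes xs \<phi>s :: "'a::field vec list"
  assumes l: "length xs = length \<phi>s" and c: "set xs \<subseteq> carrier_vec n" "set \<phi>s \<subseteq> carrier_vec n"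
    and s: "poly_splits (char_poly (outer n xs \<phi>s))"
  shows "poly_splits (char_poly (mat (length xs) (length xs) (\<lambda>(i, j). \<phi>s ! i \<bullet> xs ! j)))"
proof -
  have "poly_splits (char_poly (mat_of_rows n \<phi>s * mat_of_cols n xs))"
    by (rule char_poly_product_splits_swap[of _ n "length xs"]) (use s l in \<open>auto simp: outer_eq_mult\<close>)
  also have "mat_of_rows n \<phi>s * mat_of_cols n xs = mat (length xs) (length xs) (\<lambda>(i, j). \<phi>s ! i \<bullet> xs ! j)"
    using l c by (intro eq_matI) (auto simp: subset_iff)
  finally show ?thesis .
qed

lemma mutual_rank_ones_imp_all_squares:
  fixes V :: "'a::field mat set"
  assumes V: "matrix_subspace n V" and split: "\<And>A. A \<in> V \<Longrightarrow> poly_splits (char_poly A)"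
    and c: "x \<in> carrier_vec n" "y \<in> carrier_vec n" "\<phi> \<in> carrier_vec n" "\<psi> \<in> carrier_vec n"
    and mem: "outer n [x] [\<phi>] \<in> V" "outer n [y] [\<psi>] \<in> V"
    and z: "\<phi> \<bullet> x = 0" "\<psi> \<bullet> y = 0" and nz: "\<phi> \<bullet> y \<noteq> 0" "\<psi> \<bullet> x \<noteq> 0"
  shows "\<exists>r. r\<^sup>2 = (a::'a)"
proof -
  define s where "s = a / ((\<phi> \<bullet> y) * (\<psi> \<bullet> x))"
  have "outer n [x] [s \<cdot>\<^sub>v \<phi>] \<in> V"
    using V mem(1) by (simp add: outer_smult[OF c(3)] matrix_subspace_def)
  then have "outer n [x, y] [s \<cdot>\<^sub>v \<phi>, \<psi>] \<in> V" using mem(2) by (intro outer_mem[OF V]) auto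
  then have "poly_splits (char_poly (mat 2 2 (\<lambda>(i, j). [s \<cdot>\<^sub>v \<phi>, \<psi>] ! i \<bullet> [x, y] ! j)))"
    using gram_splits[of "[x, y]" "[s \<cdot>\<^sub>v \<phi>, \<psi>]" n] split c by (simp add: numeral_2_eq_2)
  from char_poly_2_hollow_splits[OF _ _ _ this] c z
  obtain r where "r\<^sup>2 = s * (\<phi> \<bullet> y) * (\<psi> \<bullet> x)" by auto
  then show ?thesis using nz by (intro exI[of _ r]) (simp add: s_def)
qed

section \<open>Pairs of vectors that do not annihilate each other\<close>

text \<open>
  If every pair fails in one of the two directions, then the set \<open>Z\<close> of failing pairs and its converse
  cover \<open>S \<times> S\<close>. Both have at most half of its size and both contain the diagonal, so they are too small.
\<close>
lemma mutual_pair: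
  assumes S: "finite S" "S \<noteq> {}" and irr: "\<And>x. x \<in> S \<Longrightarrow> \<not> R x x"
    and half: "\<And>x. x \<in> S \<Longrightarrow> 2 * card {y\<in>S. \<not> R x y} \<le> card S"
  shows "\<exists>x\<in>S. \<exists>y\<in>S. R x y \<and> R y x"
proof (rule ccontr)
  assume neg: "\<not> ?thesis"
  define Z where "Z = (SIGMA x:S. {y\<in>S. \<not> R x y})"
  have fZ: "finite Z" using S by (auto simp: Z_def)
  obtain s where s: "s \<in> S" using S by blast
  have "2 * card Z = (\<Sum>x\<in>S. 2 * card {y\<in>S. \<not> R x y})"
    using S by (simp add: Z_def sum_distrib_left)
  also have "\<dots> \<le> (\<Sum>x\<in>S. card S)" using half by (intro sum_mono) auto
  finally have Z: "2 * card Z \<le> card S * card S" by simp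
  have "S \<times> S = Z \<union> Z\<inverse>" using neg by (auto simp: Z_def)
  then have "card S * card S = card (Z \<union> Z\<inverse>)" by (metis card_cartesian_product)
  moreover have "card (Z \<union> Z\<inverse>) + card (Z \<inter> Z\<inverse>) = card Z + card (Z\<inverse>)"
    using card_Un_Int[of Z "Z\<inverse>"] fZ by simp
  moreover have "card (Z\<inverse>) = card Z" by simp
  moreover have "card (Z \<inter> Z\<inverse>) > 0"
    using fZ s irr by (auto simp: card_gt_0_iff Z_def)
  ultimately show False using Z by linarith
qed

definition moment :: "nat \<Rightarrow> 'a::field \<Rightarrow> 'a vec" where
  "moment n t = vec n (\<lambda>i. t ^ i)"

lemma moment_carrier [simp]: "moment n t \<in> carrier_vec n"
  by (simp add: moment_def)

lemma card_moment_zeros: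
  fixes \<phi> :: "'a::field vec"
  assumes \<phi>: "\<phi> \<in> carrier_vec n" "\<phi> \<noteq> 0\<^sub>v n"
  shows "finite {t. \<phi> \<bullet> moment n t = 0}" "card {t. \<phi> \<bullet> moment n t = 0} < n"
proof -
  define p where "p = (\<Sum>i<n. monom (\<phi> $ i) i)"
  have p: "poly p t = \<phi> \<bullet> moment n t" for t
    using \<phi>(1) by (simp add: p_def poly_sum poly_monom scalar_prod_def moment_def lessThan_atLeast0)
  have coeff: "coeff p i = (if i < n then \<phi> $ i else 0)" for i
    by (simp add: p_def coeff_sum sum.delta)
  obtain i where i: "i < n" "\<phi> $ i \<noteq> 0"
    using \<phi> by (metis eq_vecI carrier_vecD index_zero_vec)
  then have p0: "p \<noteq> 0" using coeff[of i] by auto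
  have "degree p < n" using i by (intro degree_lessI) (auto simp: coeff p0)
  moreover have "card {t. poly p t = 0} \<le> degree p" by (rule card_poly_roots_bound[OF p0])
  ultimately show "finite {t. \<phi> \<bullet> moment n t = 0}" "card {t. \<phi> \<bullet> moment n t = 0} < n"
    using poly_roots_finite[OF p0] by (simp_all add: p)
qed

text \<open>
  Each \<open>\<phi> s\<close> has fewer than \<open>n\<close> zeros on the moment curve, so \<open>2 n + 1\<close> points suffice for the count.
\<close>
lemma mutual_moment_pair:
  fixes \<phi> :: "'a::field \<Rightarrow> 'a vec"
  assumes inf: "infinite T" and \<phi>: "\<And>t. t \<in> T \<Longrightarrow> \<phi> t \<in> carrier_vec n \<and> \<phi> t \<noteq> 0\<^sub>v n \<and> \<phi> t \<bullet> moment n t = 0"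
  shows "\<exists>s\<in>T. \<exists>t\<in>T. \<phi> s \<bullet> moment n t \<noteq> 0 \<and> \<phi> t \<bullet> moment n s \<noteq> 0"
proof -
  obtain S where S: "finite S" "S \<subseteq> T" "card S = 2 * n + 1" using infinite_arbitrarily_large[OF inf] by blast
  have "\<exists>s\<in>S. \<exists>t\<in>S. \<phi> s \<bullet> moment n t \<noteq> 0 \<and> \<phi> t \<bullet> moment n s \<noteq> 0"
  proof (rule mutual_pair[OF S(1)])
    show "S \<noteq> {}" using S(3) by auto
    show "\<not> \<phi> x \<bullet> moment n x \<noteq> 0" if "x \<in> S" for x using \<phi> S that by blast
    show "2 * card {y \<in> S. \<not> \<phi> x \<bullet> moment n y \<noteq> 0} \<le> card S" if "x \<in> S" for x
    proof -
      have x: "\<phi> x \<in> carrier_vec n" "\<phi> x \<noteq> 0\<^sub>v n" using \<phi> S that by blast+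
      have "card {y \<in> S. \<not> \<phi> x \<bullet> moment n y \<noteq> 0} \<le> card {t. \<phi> x \<bullet> moment n t = 0}"
        by (rule card_mono[OF card_moment_zeros(1)[OF x]]) auto
      then show ?thesis using card_moment_zeros(2)[OF x] S(3) by linarith
    qed
  qed
  then show ?thesis using S(2) by blast
qed

text \<open>
  A two-colouring of the pairs of points. An infinite set all of whose pairs fail is impossible, since
  already \<open>mutual_moment_pair\<close> finds a pair in it that does not.
\<close>
lemma mutual_moment_clique:
  fixes \<phi> :: "'a::field \<Rightarrow> 'a vec"
  assumes inf: "infinite (UNIV :: 'a set)" and \<phi>: "\<And>t. \<phi> t \<in> carrier_vec n \<and> \<phi> t \<noteq> 0\<^sub>v n \<and> \<phi> t \<bullet> moment n t = 0"
  obtains T where "infinite T" "\<And>s t. s \<in> T \<Longrightarrow> t \<in> T \<Longrightarrow> s \<noteq> t \<Longrightarrow> \<phi> s \<bullet> moment n t \<noteq> 0"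
proof -
  define f :: "'a set \<Rightarrow> nat" where
    "f X = (if \<forall>s\<in>X. \<forall>t\<in>X. s \<noteq> t \<longrightarrow> \<phi> s \<bullet> moment n t \<noteq> 0 then 0 else 1)" for X
  have "\<forall>x\<in>UNIV. \<forall>y\<in>UNIV. x \<noteq> y \<longrightarrow> f {x, y} < 2" by (simp add: f_def)
  from Ramsey2[OF inf this] obtain T c
    where T: "infinite T" and Tc: "\<forall>x\<in>T. \<forall>y\<in>T. x \<noteq> y \<longrightarrow> f {x, y} = c"
    by (elim exE conjE) (rule that)
  obtain s t where st: "s \<in> T" "t \<in> T" "\<phi> s \<bullet> moment n t \<noteq> 0" "\<phi> t \<bullet> moment n s \<noteq> 0"
    using mutual_moment_pair[OF T, of \<phi> n] \<phi> by metis
  then have "s \<noteq> t" using \<phi> by auto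
  moreover have "f {s, t} = 0" using st by (auto simp: f_def)
  ultimately have "c = 0" using Tc st(1,2) by metis
  show ?thesis
  proof (rule that[OF T])
    fix s t assume "s \<in> T" "t \<in> T" "s \<noteq> t"
    then have "f {s, t} = 0" using Tc \<open>c = 0\<close> by metis
    then show "\<phi> s \<bullet> moment n t \<noteq> 0" using \<open>s \<noteq> t\<close> unfolding f_def by (auto split: if_splits)
  qed
qed

text \<open>
  Here the moment curve may have too few points, and all vectors with first coordinate 1 are used. As
  \<open>\<phi> x\<close> vanishes at \<open>x\<close>, it has a nonzero coordinate \<open>j \<noteq> 0\<close>; adding the \<open>j\<close>-th unit vector maps its
  zeros injectively to vectors that are not zeros.
\<close>
lemma mutual_pair_finite_field:
  fixes \<phi> :: "'a::field vec \<Rightarrow> 'a vec"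
  assumes fin: "finite (UNIV :: 'a set)" and n: "n > 0"
    and \<phi>: "\<And>x. x \<in> carrier_vec n \<Longrightarrow> x $ 0 = 1 \<Longrightarrow> \<phi> x \<in> carrier_vec n \<and> \<phi> x \<noteq> 0\<^sub>v n \<and> \<phi> x \<bullet> x = 0"
  shows "\<exists>x\<in>carrier_vec n. \<exists>y\<in>carrier_vec n. x $ 0 = 1 \<and> y $ 0 = 1 \<and> \<phi> x \<bullet> y \<noteq> 0 \<and> \<phi> y \<bullet> x \<noteq> 0"
proof -
  define S where "S = {x \<in> carrier_vec n. x $ 0 = (1::'a)}"
  have "carrier_vec n \<subseteq> vec_of_list ` {xs. set xs \<subseteq> (UNIV :: 'a set) \<and> length xs = n}"
    by (auto intro!: image_eqI[of _ _ "list_of_vec _"] simp: vec_list)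
  then have "finite (carrier_vec n :: 'a vec set)"
    by (rule finite_subset) (rule finite_imageI, rule finite_lists_length_eq[OF fin])
  then have fS: "finite S" by (simp add: S_def)
  have "\<exists>x\<in>S. \<exists>y\<in>S. \<phi> x \<bullet> y \<noteq> 0 \<and> \<phi> y \<bullet> x \<noteq> 0"
  proof (rule mutual_pair[OF fS])
    have "unit_vec n 0 \<in> S" using n by (simp add: S_def)
    then show "S \<noteq> {}" by blast
    show "\<not> \<phi> x \<bullet> x \<noteq> 0" if "x \<in> S" for x using that \<phi> by (simp add: S_def)
    fix x assume x: "x \<in> S"
    then have p: "\<phi> x \<in> carrier_vec n" "\<phi> x \<noteq> 0\<^sub>v n" "\<phi> x \<bullet> x = 0" using \<phi> by (auto simp: S_def)
    have "\<exists>j<n. j \<noteq> 0 \<and> \<phi> x $ j \<noteq> 0"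
    proof (rule ccontr)
      assume neg: "\<not> ?thesis"
      have "\<phi> x \<bullet> x = (\<Sum>j\<in>{0..<n}. \<phi> x $ j * x $ j)"
        using x by (auto simp: scalar_prod_def S_def)
      also have "\<dots> = (\<Sum>j\<in>{0..<n}. if j = 0 then \<phi> x $ 0 else 0)"
        by (rule sum.cong[OF refl]) (use x neg in \<open>auto simp: S_def\<close>)
      finally have "\<phi> x $ 0 = 0" using p(3) n by (simp add: sum.delta)
      then have "\<phi> x $ j = 0" if "j < n" for j using neg that by (cases "j = 0") auto
      then have "\<phi> x = 0\<^sub>v n" using p(1) by (intro eq_vecI) auto
      then show False using p(2) by blast
    qed
    then obtain j where j: "j < n" "j \<noteq> 0" "\<phi> x $ j \<noteq> 0" by blast
    let ?Z = "{y\<in>S. \<not> \<phi> x \<bullet> y \<noteq> 0}"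
    let ?t = "\<lambda>y. y + unit_vec n j"
    have "inj_on ?t ?Z"
    proof (rule inj_onI)
      fix y z assume yz: "y \<in> ?Z" "z \<in> ?Z" "?t y = ?t z"
      then have c: "y \<in> carrier_vec n" "z \<in> carrier_vec n" by (auto simp: S_def)
      have "y $ i = z $ i" if "i < n" for i
        using arg_cong[OF yz(3), of "\<lambda>v. v $ i"] that c by simp
      then show "y = z" using c by (intro eq_vecI) auto
    qed
    moreover have "?t ` ?Z \<subseteq> S - ?Z"
    proof safe
      fix y assume y: "y \<in> S"
      then show "?t y \<in> S" using j n by (auto simp: S_def)
      assume "\<phi> x \<bullet> y = 0" "\<phi> x \<bullet> ?t y = 0"
      moreover have "\<phi> x \<bullet> ?t y = \<phi> x \<bullet> y + \<phi> x $ j"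
        using y p(1) j by (simp add: S_def scalar_prod_add_distrib[of _ n])
      ultimately show False using j by simp
    qed
    ultimately have "card ?Z \<le> card (S - ?Z)"
      using fS by (intro card_inj_on_le[of ?t]) auto
    also have "\<dots> = card S - card ?Z" using fS by (intro card_Diff_subset) auto
    finally show "2 * card ?Z \<le> card S" using card_mono[OF fS, of ?Z] by auto
  qed
  then show ?thesis by (auto simp: S_def)
qed

section \<open>Pencils of hollow matrices in characteristic 2\<close>

lemma exists_nonroot:
  fixes p :: "'a::field poly"
  assumes "infinite (UNIV :: 'a set)" "p \<noteq> 0"
  shows "\<exists>t. poly p t \<noteq> 0"
  using poly_roots_finite[OF assms(2)] ex_new_if_finite[OF assms(1)] by blast

text \<open>
  The hypothesis concerns the matrix with rows \<open>u (0, a, b)\<close>, \<open>v (a', 0, c)\<close>, \<open>w (b', c', 0)\<close>; the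
  conclusion is that the weights of its two oriented 3-cycles cancel. Otherwise the row factors can be
  chosen such that two of the three summands of \<open>p\<close> are equal, hence cancel in characteristic 2, and what
  is left is adjusted to \<open>p\<^sup>3 = k q\<^sup>2\<close> by extracting a square root.
\<close>
lemma hollow_cycles_cancel:
  fixes a a' b b' c c' k :: "'a::field"
  assumes 2: "(2::'a) = 0" and sq: "\<And>x::'a. \<exists>r. r\<^sup>2 = x" and k: "k \<noteq> 0"
    and nz: "a \<noteq> 0" "a' \<noteq> 0" "b \<noteq> 0" "b' \<noteq> 0" "c \<noteq> 0" "c' \<noteq> 0"
    and H: "\<And>u v w. (u * v * (a * a') + u * w * (b * b') + v * w * (c * c')) ^ 3
        = k * (u * v * w * (a * c * b' + b * c' * a'))\<^sup>2 \<Longrightarrow> u * v * w * (a * c * b' + b * c' * a') = 0"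
  shows "a * c * b' + b * c' * a' = 0"
proof (rule ccontr)
  define \<alpha> \<beta> \<gamma> m where "\<alpha> = a * a'" and "\<beta> = b * b'" and "\<gamma> = c * c'" and m: "m = a * c * b' + b * c' * a'"
  assume "\<not> ?thesis"
  then have m0: "m \<noteq> 0" by (simp add: m)
  have nz': "\<alpha> \<noteq> 0" "\<beta> \<noteq> 0" "\<gamma> \<noteq> 0" using nz by (auto simp: \<alpha>_def \<beta>_def \<gamma>_def)
  \<comment> \<open>the value for which the factors 1, \<open>\<beta> / X\<close>, \<open>\<alpha> / X\<close> give \<open>p\<^sup>3 = k q\<^sup>2\<close>\<close>
  obtain X where X: "X\<^sup>2 = \<gamma> ^ 3 * \<alpha> * \<beta> / (k * m\<^sup>2)" using sq by blast
  then have X0: "X \<noteq> 0" using nz' k m0 by auto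
  let ?v = "\<beta> / X" and ?w = "\<alpha> / X"
  have "1 * ?v * \<alpha> + 1 * ?w * \<beta> + ?v * ?w * \<gamma> = 2 * (\<alpha> * \<beta> / X) + \<alpha> * \<beta> * \<gamma> / X\<^sup>2"
    unfolding mult_2 by (simp add: power2_eq_square mult.commute mult.left_commute)
  then have p: "1 * ?v * \<alpha> + 1 * ?w * \<beta> + ?v * ?w * \<gamma> = \<alpha> * \<beta> * \<gamma> / X\<^sup>2" using 2 by simp
  have q: "1 * ?v * ?w * m = \<alpha> * \<beta> * m / X\<^sup>2" by (simp add: power2_eq_square)
  have X2: "k * m\<^sup>2 * X\<^sup>2 = \<gamma> ^ 3 * \<alpha> * \<beta>" using X k m0 by simp
  have "k * (\<alpha> * \<beta> * m / X\<^sup>2)\<^sup>2 = (k * m\<^sup>2 * X\<^sup>2) * (\<alpha> * \<beta>)\<^sup>2 / X ^ 6"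
    using X0 by (simp add: field_simps eval_nat_numeral)
  also have "\<dots> = (\<alpha> * \<beta> * \<gamma> / X\<^sup>2) ^ 3"
    unfolding X2 by (simp add: field_simps eval_nat_numeral)
  finally have "(\<alpha> * \<beta> * \<gamma> / X\<^sup>2) ^ 3 = k * (\<alpha> * \<beta> * m / X\<^sup>2)\<^sup>2" ..
  then have "\<alpha> * \<beta> * m / X\<^sup>2 = 0"
    using H[of 1 ?v ?w, folded \<alpha>_def \<beta>_def \<gamma>_def m, unfolded p q] by blast
  then show False using nz' m0 X0 by simp
qed

text \<open>
  The same matrix with the multiple \<open>s (0, 0, l)\<close> of a further row added to its first row and \<open>s (0, 0, h)\<close>
  to its second one. Put \<open>v = 1\<close>. Since the two 3-cycles of the unperturbed matrix cancel, \<open>q = \<sigma> \<kappa>\<close>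
  and \<open>p = A + w \<beta> + \<sigma> \<epsilon>\<close> with \<open>\<sigma> = s w\<close> and coefficients depending on \<open>u\<close> only. The relation \<open>p\<^sup>3 = k q\<^sup>2\<close> is
  parametrized by \<open>p = k \<tau>\<^sup>2\<close>, \<open>q = k \<tau>\<^sup>3\<close>, and both equations can be solved for \<open>\<sigma>\<close> and \<open>w\<close>.
\<close>
lemma hollow_pencil_trivial:
  fixes a a' b b' c c' k l h :: "'a::field"
  assumes inf: "infinite (UNIV :: 'a set)" and k: "k \<noteq> 0"
    and nz: "a \<noteq> 0" "a' \<noteq> 0" "b \<noteq> 0" "b' \<noteq> 0" "c \<noteq> 0" "c' \<noteq> 0"
    and m: "a * c * b' + b * c' * a' = 0"
    and H: "\<And>u v w s. (u * a * (v * a') + (u * b + s * l) * (w * b') + (v * c + s * h) * (w * c')) ^ 3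
        = k * (u * a * (v * c + s * h) * (w * b') + (u * b + s * l) * (w * c') * (v * a'))\<^sup>2
        \<Longrightarrow> u * a * (v * c + s * h) * (w * b') + (u * b + s * l) * (w * c') * (v * a') = 0"
  shows "l = 0 \<and> h = 0"
proof (rule ccontr)
  assume lh: "\<not> ?thesis"
  \<comment> \<open>these two polynomials in \<open>u\<close> are \<open>\<kappa>\<close> and \<open>\<beta>\<close>\<close>
  have "[:c' * a' * l, a * b' * h:] * [:c * c', b * b':] \<noteq> 0" using lh nz by (simp only: mult_eq_0_iff) auto
  from exists_nonroot[OF inf this] obtain u
    where "poly [:c' * a' * l, a * b' * h:] u \<noteq> 0 \<and> poly [:c * c', b * b':] u \<noteq> 0"
    unfolding poly_mult by auto
  then have u: "c' * a' * l + u * (a * b' * h) \<noteq> 0" "c * c' + u * (b * b') \<noteq> 0" by auto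
  define \<kappa> where "\<kappa> = c' * a' * l + u * (a * b' * h)"
  define \<beta> where "\<beta> = c * c' + u * (b * b')"
  define \<epsilon> where "\<epsilon> = b' * l + c' * h"
  define A where "A = u * a * a'"
  have \<kappa>: "\<kappa> \<noteq> 0" and \<beta>: "\<beta> \<noteq> 0" using u by (auto simp: \<kappa>_def \<beta>_def)
  \<comment> \<open>the second factor is, as a polynomial in \<open>\<tau>\<close>, the numerator of \<open>w\<close>, which must not vanish because
    \<open>s\<close> is recovered as \<open>\<sigma> / w\<close>\<close>
  have "[:0, 1:] * [:- A, 0, k, - (k * \<epsilon> / \<kappa>):] \<noteq> 0" using k by (simp only: mult_eq_0_iff) auto
  from exists_nonroot[OF inf this] obtain \<tau>
    where "poly [:0, 1:] \<tau> \<noteq> 0 \<and> poly [:- A, 0, k, - (k * \<epsilon> / \<kappa>):] \<tau> \<noteq> 0"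
    unfolding poly_mult by auto
  then have \<tau>: "\<tau> \<noteq> 0" "- A + \<tau> * (\<tau> * (k + \<tau> * - (k * \<epsilon> / \<kappa>))) \<noteq> 0" by auto
  define \<sigma> where "\<sigma> = k * \<tau> ^ 3 / \<kappa>"
  define w where "w = (k * \<tau>\<^sup>2 - A - \<sigma> * \<epsilon>) / \<beta>"
  have "k * \<tau>\<^sup>2 - A - \<sigma> * \<epsilon> = - A + \<tau> * (\<tau> * (k + \<tau> * - (k * \<epsilon> / \<kappa>)))"
    by (simp add: \<sigma>_def power2_eq_square power3_eq_cube algebra_simps)
  then have "k * \<tau>\<^sup>2 - A - \<sigma> * \<epsilon> \<noteq> 0" using \<tau>(2) by metis
  then have w: "w \<noteq> 0" unfolding w_def using \<beta> by (simp only: divide_eq_0_iff) blast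
  define s where "s = \<sigma> / w"
  have sw: "s * w = \<sigma>" using w by (simp add: s_def)
  have "u * a * (1 * a') + (u * b + s * l) * (w * b') + (1 * c + s * h) * (w * c') = A + w * \<beta> + (s * w) * \<epsilon>"
    by (simp add: A_def \<beta>_def \<epsilon>_def algebra_simps)
  also have "w * \<beta> = k * \<tau>\<^sup>2 - A - \<sigma> * \<epsilon>" using \<beta> by (simp add: w_def)
  also have "A + (k * \<tau>\<^sup>2 - A - \<sigma> * \<epsilon>) + s * w * \<epsilon> = k * \<tau>\<^sup>2" unfolding sw by simp
  finally have p: "u * a * (1 * a') + (u * b + s * l) * (w * b') + (1 * c + s * h) * (w * c') = k * \<tau>\<^sup>2" .
  have "u * a * (1 * c + s * h) * (w * b') + (u * b + s * l) * (w * c') * (1 * a')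
      = w * u * (a * c * b' + b * c' * a') + (s * w) * \<kappa>"
    by (simp add: \<kappa>_def algebra_simps)
  also have "\<dots> = k * \<tau> ^ 3" using \<kappa> by (simp add: m sw \<sigma>_def)
  finally have q: "u * a * (1 * c + s * h) * (w * b') + (u * b + s * l) * (w * c') * (1 * a') = k * \<tau> ^ 3" .
  have "(k * \<tau>\<^sup>2) ^ 3 = k * (k * \<tau> ^ 3)\<^sup>2" by (simp add: eval_nat_numeral algebra_simps)
  then have "k * \<tau> ^ 3 = 0" using H[of u 1 s w, unfolded p q] by blast
  then show False using k \<tau>(1) by simp
qed

section \<open>The upper bound\<close>

text \<open>
  The companion matrix \<open>C\<close> of a quadratic polynomial without roots is not in \<open>V\<close>. The three forms are
  chosen such that their common zeros are the multiples of \<open>C\<close>.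
\<close>
lemma separated_by_forms_2:
  fixes V :: "'a::field mat set"
  assumes nqc: "\<not> quadratically_closed TYPE('a)"
    and V: "matrix_subspace 2 V" and split: "\<And>A. A \<in> V \<Longrightarrow> poly_splits (char_poly A)"
  shows "separated_by_forms 2 V 3"
proof -
  obtain b c :: 'a where bc: "\<And>t. t\<^sup>2 + b * t + c \<noteq> 0" using not_quadratically_closed_irreducible[OF nqc] by blast
  define C where "C = mat_of_rows_list 2 [[0, - c], [1, - b]]"
  have C: "C \<in> carrier_mat 2 2" "C $$ (0,0) = 0" "C $$ (0,1) = - c" "C $$ (1,0) = 1" "C $$ (1,1) = - b"
    by (auto simp: C_def mat_of_rows_list_def)
  have cp: "char_poly C = [:c, b, 1:]"
    unfolding char_poly_def by (subst det_mat_2) (use C in \<open>auto simp: char_poly_matrix_def\<close>)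
  have "C \<notin> V"
  proof
    assume "C \<in> V"
    then have "poly_splits [:c, b, 1:]" using split cp by metis
    then obtain r where "poly [:c, b, 1:] r = 0" by (subst (asm) poly_splits_quadratic_iff) auto
    then show False using bc[of r] by (simp add: power2_eq_square algebra_simps)
  qed
  define fs :: "('a mat \<Rightarrow> 'a) list" where
    "fs = [\<lambda>A. A $$ (0,0), \<lambda>A. A $$ (0,1) + c * A $$ (1,0), \<lambda>A. A $$ (1,1) + b * A $$ (1,0)]"
  have "\<forall>f\<in>set fs. matrix_form 2 f"
    by (auto simp: fs_def matrix_form_def algebra_simps)
  moreover have "A = 0\<^sub>m 2 2" if A: "A \<in> V" "\<forall>f\<in>set fs. f A = 0" for A
  proof -
    have Ac: "A \<in> carrier_mat 2 2" using A V by (auto simp: matrix_subspace_def)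
    have e: "A $$ (0,0) = 0" "A $$ (0,1) = - c * A $$ (1,0)" "A $$ (1,1) = - b * A $$ (1,0)"
      using A(2) by (auto simp: fs_def add_eq_0_iff2)
    have AC: "A = (A $$ (1,0)) \<cdot>\<^sub>m C"
      using Ac C e by (intro eq_matI) (auto simp: less_2_cases_iff)
    have "A $$ (1,0) = 0"
    proof (rule ccontr)
      assume nz: "A $$ (1,0) \<noteq> 0"
      have "C = inverse (A $$ (1,0)) \<cdot>\<^sub>m A"
        using nz C by (subst AC) (auto intro!: eq_matI)
      then have "C \<in> V" using V A(1) unfolding matrix_subspace_def by metis
      then show False using \<open>C \<notin> V\<close> by blast
    qed
    then show ?thesis using Ac e by (intro eq_matI) (auto simp: less_2_cases_iff)
  qed
  ultimately show ?thesis unfolding separated_by_forms_def by (intro exI[of _ fs]) (auto simp: fs_def)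
qed

text \<open>
  The case \<open>k = 1\<close> of \<open>separating_block\<close>; the numbers match since \<open>m + 1 + m (m + 1) / 2 = n (n + 1) / 2\<close>
  for \<open>n = m + 1\<close>.
\<close>
lemma rank_one_square_zero_exists:
  fixes V :: "'a::field mat set"
  assumes n: "n \<ge> 2" and V: "matrix_subspace n V" and split: "\<And>A. A \<in> V \<Longrightarrow> poly_splits (char_poly A)"
    and IH: "\<And>m (W :: 'a mat set). 1 \<le> m \<Longrightarrow> m < n \<Longrightarrow> matrix_subspace m W \<Longrightarrow>
      \<forall>A\<in>W. poly_splits (char_poly A) \<Longrightarrow> separated_by_forms m W (m * (m + 1) div 2)"
    and nonsep: "\<not> separated_by_forms n V (n * (n + 1) div 2)"
    and x: "x \<in> carrier_vec n" "x $ 0 = 1"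
  shows "\<exists>\<phi>. \<phi> \<in> carrier_vec n \<and> \<phi> \<noteq> 0\<^sub>v n \<and> \<phi> \<bullet> x = 0 \<and> outer n [x] [\<phi>] \<in> V"
proof -
  obtain m where m: "n = 1 + m" "1 \<le> m" using n by (intro that[of "n - 1"]) auto
  have ar: "m * 1 + 1 * (1 + 1) div 2 + m * (m + 1) div 2 = n * (n + 1) div 2"
  proof -
    have "n * (n + 1) = m * (m + 1) + (m + 1) * 2" by (simp add: m algebra_simps)
    then show ?thesis by simp
  qed
  let ?X = "mat_of_cols n [x]"
  have "\<exists>L\<in>carrier_mat 1 (1 + m). L * ?X = 0\<^sub>m 1 1 \<and> ?X * L \<in> V \<and> ?X * L \<noteq> 0\<^sub>m (1 + m) (1 + m)"
  proof (rule separating_block[where d = "1 * (1 + 1) div 2" and e = "m * (m + 1) div 2" and B' = "1\<^sub>m 1"])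
    show "1\<^sub>m 1 * mat 1 1 (\<lambda>p. ?X $$ p) = 1\<^sub>m 1"
      using x n by (intro eq_matI) (auto simp: mat_of_cols_index)
    show "\<not> separated_by_forms (1 + m) V (m * 1 + 1 * (1 + 1) div 2 + m * (m + 1) div 2)"
      using nonsep ar m by simp
  qed (use V split IH[of 1] IH[of m] m n in auto)
  then obtain L where L: "L \<in> carrier_mat 1 n" "L * ?X = 0\<^sub>m 1 1" "?X * L \<in> V" "?X * L \<noteq> 0\<^sub>m n n"
    using m by auto
  have rows: "mat_of_rows n [row L 0] = L"
    using L(1) by (intro eq_matI) (auto simp: mat_of_rows_index)
  have o: "outer n [x] [row L 0] = ?X * L" by (simp add: outer_eq_mult rows)
  have "(L * ?X) $$ (0, 0) = row L 0 \<bullet> x" using L(1) x by simp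
  then have "row L 0 \<bullet> x = 0" using L(2) by simp
  moreover have "row L 0 \<noteq> 0\<^sub>v n"
  proof
    assume "row L 0 = 0\<^sub>v n"
    then have "outer n [x] [row L 0] = 0\<^sub>m n n" by (intro eq_matI) (auto simp: outer_def)
    then show False using L(4) o by simp
  qed
  ultimately show ?thesis using L o by (intro exI[of _ "row L 0"]) auto
qed

text \<open>
  The case \<open>k = 2\<close> of \<open>separating_block\<close>. The hypotheses on \<open>x\<close> and \<open>y\<close> make the top block
  \<open>(1, 1; x\<^sub>1, y\<^sub>1)\<close> invertible, and \<open>2 m + 3 + m (m + 1) / 2 = n (n + 1) / 2\<close> for \<open>n = m + 2\<close>.
\<close>
lemma square_zero_into_plane_exists:
  fixes V :: "'a::field mat set"
  assumes n: "n \<ge> 3" and V: "matrix_subspace n V" and split: "\<And>A. A \<in> V \<Longrightarrow> poly_splits (char_poly A)"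
    and IH: "\<And>m (W :: 'a mat set). 1 \<le> m \<Longrightarrow> m < n \<Longrightarrow> matrix_subspace m W \<Longrightarrow>
      \<forall>A\<in>W. poly_splits (char_poly A) \<Longrightarrow> separated_by_forms m W (m * (m + 1) div 2)"
    and nonsep: "\<not> separated_by_forms n V (n * (n + 1) div 2)"
    and x: "x \<in> carrier_vec n" "x $ 0 = 1" and y: "y \<in> carrier_vec n" "y $ 0 = 1" and xy: "x $ 1 \<noteq> y $ 1"
  shows "\<exists>\<xi> \<eta>. \<xi> \<in> carrier_vec n \<and> \<eta> \<in> carrier_vec n \<and> (\<xi> \<noteq> 0\<^sub>v n \<or> \<eta> \<noteq> 0\<^sub>v n)
    \<and> \<xi> \<bullet> x = 0 \<and> \<xi> \<bullet> y = 0 \<and> \<eta> \<bullet> x = 0 \<and> \<eta> \<bullet> y = 0 \<and> outer n [x, y] [\<xi>, \<eta>] \<in> V"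
proof -
  obtain m where m: "n = 2 + m" "1 \<le> m" using n by (intro that[of "n - 2"]) auto
  have ar: "m * 2 + 2 * (2 + 1) div 2 + m * (m + 1) div 2 = n * (n + 1) div 2"
  proof -
    have "n * (n + 1) = m * (m + 1) + (m * 2 + 3) * 2" by (simp add: m algebra_simps)
    then show ?thesis by simp
  qed
  let ?X = "mat_of_cols n [x, y]"
  define D where "D = y $ 1 - x $ 1"
  have D: "D \<noteq> 0" using xy by (simp add: D_def)
  define B' where "B' = mat_of_rows_list 2 [[y $ 1 / D, - 1 / D], [- x $ 1 / D, 1 / D]]"
  have B': "B' \<in> carrier_mat 2 2" "B' $$ (0,0) = y $ 1 / D" "B' $$ (0,1) = - 1 / D"
    "B' $$ (1,0) = - x $ 1 / D" "B' $$ (1,1) = 1 / D"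
    by (auto simp: B'_def mat_of_rows_list_def)
  have "\<exists>L\<in>carrier_mat 2 (2 + m). L * ?X = 0\<^sub>m 2 2 \<and> ?X * L \<in> V \<and> ?X * L \<noteq> 0\<^sub>m (2 + m) (2 + m)"
  proof (rule separating_block[where d = "2 * (2 + 1) div 2" and e = "m * (m + 1) div 2" and B' = B'])
    have X: "?X $$ (0,0) = 1" "?X $$ (0,1) = 1" "?X $$ (1,0) = x $ 1" "?X $$ (1,1) = y $ 1"
      using x y n by (auto simp: mat_of_cols_index)
    have e: "(B' * mat 2 2 (\<lambda>p. ?X $$ p)) $$ (i, j) = B' $$ (i,0) * ?X $$ (0,j) + B' $$ (i,1) * ?X $$ (1,j)"
      if "i < 2" "j < 2" for i j
      using that B'(1) by (simp add: scalar_prod_def numeral_2_eq_2)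
    show "B' * mat 2 2 (\<lambda>p. ?X $$ p) = 1\<^sub>m 2"
    proof (rule eq_matI)
      fix i j assume ij: "i < dim_row (1\<^sub>m 2 :: 'a mat)" "j < dim_col (1\<^sub>m 2 :: 'a mat)"
      have d: "y $ 1 / D + - 1 / D * x $ 1 = 1" "- x $ 1 / D + 1 / D * y $ 1 = 1"
        using D by (simp_all add: diff_divide_distrib[symmetric] D_def)
      have d0: "y $ 1 / D + - 1 / D * y $ 1 = 0" "- x $ 1 / D + 1 / D * x $ 1 = 0"
        by simp_all
      have "(B' * mat 2 2 (\<lambda>p. ?X $$ p)) $$ (0, 0) = 1" "(B' * mat 2 2 (\<lambda>p. ?X $$ p)) $$ (0, 1) = 0"
        "(B' * mat 2 2 (\<lambda>p. ?X $$ p)) $$ (1, 0) = 0" "(B' * mat 2 2 (\<lambda>p. ?X $$ p)) $$ (1, 1) = 1"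
        using e[of 0 0] e[of 0 1] e[of 1 0] e[of 1 1] d d0 unfolding B'(2-5) X by simp_all
      then show "(B' * mat 2 2 (\<lambda>p. ?X $$ p)) $$ (i, j) = 1\<^sub>m 2 $$ (i, j)"
        using ij by (auto simp: less_2_cases_iff)
    qed (use B' in auto)
    show "\<not> separated_by_forms (2 + m) V (m * 2 + 2 * (2 + 1) div 2 + m * (m + 1) div 2)"
      using nonsep unfolding ar m(1)[symmetric] .
    show "separated_by_forms 2 W (2 * (2 + 1) div 2)"
      if "matrix_subspace 2 W" "\<forall>A\<in>W. poly_splits (char_poly A)" for W :: "'a mat set"
      using IH[of 2 W] that n by simp
    show "separated_by_forms m W (m * (m + 1) div 2)"
      if "matrix_subspace m W" "\<forall>A\<in>W. poly_splits (char_poly A)" for W :: "'a mat set"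
      using IH[of m W] that m by simp
  qed (use V split m B' in auto)
  then obtain L where L: "L \<in> carrier_mat 2 n" "L * ?X = 0\<^sub>m 2 2" "?X * L \<in> V" "?X * L \<noteq> 0\<^sub>m n n"
    using m by auto
  have rows: "mat_of_rows n [row L 0, row L 1] = L"
    using L(1) by (intro eq_matI) (auto simp: mat_of_rows_index less_Suc_eq numeral_2_eq_2)
  have o: "outer n [x, y] [row L 0, row L 1] = ?X * L"
    using outer_eq_mult[of "[x, y]" "[row L 0, row L 1]" n] unfolding rows by simp
  have "row L i \<bullet> [x, y] ! j = 0" if "i < 2" "j < 2" for i j
  proof -
    have "(L * ?X) $$ (i, j) = row L i \<bullet> [x, y] ! j"
      using L(1) x y that by (subst index_mult_mat) (auto simp: less_2_cases_iff)
    then show ?thesis using L(2) that by simp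
  qed
  from this[of 0 0] this[of 0 1] this[of 1 0] this[of 1 1]
  have "row L 0 \<bullet> x = 0" "row L 0 \<bullet> y = 0" "row L 1 \<bullet> x = 0" "row L 1 \<bullet> y = 0" by simp_all
  moreover have "row L 0 \<noteq> 0\<^sub>v n \<or> row L 1 \<noteq> 0\<^sub>v n"
  proof (rule ccontr)
    assume "\<not> ?thesis"
    then have "outer n [x, y] [row L 0, row L 1] = 0\<^sub>m n n"
      by (intro eq_matI) (auto simp: outer_def)
    then show False using L(4) o by simp
  qed
  ultimately show ?thesis using L o by (intro exI[of _ "row L 0"] exI[of _ "row L 1"]) auto
qed

text \<open>
  For scalars \<open>u\<close>, \<open>v\<close>, \<open>w\<close>, \<open>s\<close>, the matrix \<open>u x \<phi> + v y \<psi> + w z \<chi> + s (x \<xi> + y \<eta>)\<close> lies in \<open>V\<close>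
  and has its image in the span of \<open>x\<close>, \<open>y\<close>, \<open>z\<close>. Its Gram matrix has zero diagonal and is the one of
  \<open>hollow_pencil_trivial\<close>, with \<open>l = \<xi>(z)\<close> and \<open>h = \<eta>(z)\<close>.
\<close>
lemma square_zero_into_plane_kills_third_point:
  fixes V :: "'a::field mat set"
  assumes nqc: "\<not> quadratically_closed TYPE('a)" and 2: "(2::'a) = 0" and sq: "\<And>x::'a. \<exists>r. r\<^sup>2 = x"
    and inf: "infinite (UNIV :: 'a set)"
    and V: "matrix_subspace n V" and split: "\<And>A. A \<in> V \<Longrightarrow> poly_splits (char_poly A)"
    and c: "x \<in> carrier_vec n" "y \<in> carrier_vec n" "z \<in> carrier_vec n"
      "\<phi> \<in> carrier_vec n" "\<psi> \<in> carrier_vec n" "\<chi> \<in> carrier_vec n" "\<xi> \<in> carrier_vec n" "\<eta> \<in> carrier_vec n"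
    and mem: "outer n [x] [\<phi>] \<in> V" "outer n [y] [\<psi>] \<in> V" "outer n [z] [\<chi>] \<in> V" "outer n [x, y] [\<xi>, \<eta>] \<in> V"
    and diag: "\<phi> \<bullet> x = 0" "\<psi> \<bullet> y = 0" "\<chi> \<bullet> z = 0"
    and nz: "\<phi> \<bullet> y \<noteq> 0" "\<psi> \<bullet> x \<noteq> 0" "\<phi> \<bullet> z \<noteq> 0" "\<chi> \<bullet> x \<noteq> 0" "\<psi> \<bullet> z \<noteq> 0" "\<chi> \<bullet> y \<noteq> 0"
    and plane: "\<xi> \<bullet> x = 0" "\<xi> \<bullet> y = 0" "\<eta> \<bullet> x = 0" "\<eta> \<bullet> y = 0"
  shows "\<xi> \<bullet> z = 0 \<and> \<eta> \<bullet> z = 0"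
proof -
  obtain k :: 'a where k: "k \<noteq> 0" "\<And>z::'a. z\<^sup>2 + z \<noteq> 1 + k"
    using artin_schreier_nonroot[OF nqc 2 sq inf] by blast
  define a a' b b' e e' where abc: "a = \<phi> \<bullet> y" "a' = \<psi> \<bullet> x" "b = \<phi> \<bullet> z" "b' = \<chi> \<bullet> x" "e = \<psi> \<bullet> z" "e' = \<chi> \<bullet> y"
  define l h where lh: "l = \<xi> \<bullet> z" "h = \<eta> \<bullet> z"
  have H: "u * a * (v * e + s * h) * (w * b') + (u * b + s * l) * (w * e') * (v * a') = 0"
    if eq: "(u * a * (v * a') + (u * b + s * l) * (w * b') + (v * e + s * h) * (w * e')) ^ 3
        = k * (u * a * (v * e + s * h) * (w * b') + (u * b + s * l) * (w * e') * (v * a'))\<^sup>2" for u v w s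
  proof -
    define \<Phi> where "\<Phi> = [u \<cdot>\<^sub>v \<phi> + s \<cdot>\<^sub>v \<xi>, v \<cdot>\<^sub>v \<psi> + s \<cdot>\<^sub>v \<eta>, w \<cdot>\<^sub>v \<chi>]"
    have "outer n [x] [u \<cdot>\<^sub>v \<phi>] \<in> V" "outer n [y] [v \<cdot>\<^sub>v \<psi>] \<in> V" "outer n [z] [w \<cdot>\<^sub>v \<chi>] \<in> V"
      using V mem c by (simp_all add: outer_smult matrix_subspace_def)
    then have "outer n [x, y, z] [u \<cdot>\<^sub>v \<phi>, v \<cdot>\<^sub>v \<psi>, w \<cdot>\<^sub>v \<chi>] \<in> V" by (intro outer_mem[OF V]) auto
    moreover have "s \<cdot>\<^sub>m outer n [x, y] [\<xi>, \<eta>] \<in> V" using V mem by (simp add: matrix_subspace_def)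
    ultimately have "outer n [x, y, z] [u \<cdot>\<^sub>v \<phi>, v \<cdot>\<^sub>v \<psi>, w \<cdot>\<^sub>v \<chi>] + s \<cdot>\<^sub>m outer n [x, y] [\<xi>, \<eta>] \<in> V"
      using V by (simp add: matrix_subspace_def)
    also have "outer n [x, y, z] [u \<cdot>\<^sub>v \<phi>, v \<cdot>\<^sub>v \<psi>, w \<cdot>\<^sub>v \<chi>] + s \<cdot>\<^sub>m outer n [x, y] [\<xi>, \<eta>] = outer n [x, y, z] \<Phi>"
      using c by (intro eq_matI) (auto simp: outer_def \<Phi>_def algebra_simps)
    finally have "poly_splits (char_poly (outer n [x, y, z] \<Phi>))" by (rule split)
    then have s3: "poly_splits (char_poly (mat 3 3 (\<lambda>(i, j). \<Phi> ! i \<bullet> [x, y, z] ! j)))"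
      using gram_splits[of "[x, y, z]" \<Phi> n] c by (simp add: \<Phi>_def numeral_3_eq_3)
    let ?M = "mat 3 3 (\<lambda>(i, j). \<Phi> ! i \<bullet> [x, y, z] ! j)"
    have M: "?M $$ (0,0) = 0" "?M $$ (1,1) = 0" "?M $$ (2,2) = 0"
      "?M $$ (0,1) = u * a" "?M $$ (0,2) = u * b + s * l" "?M $$ (1,0) = v * a'" "?M $$ (1,2) = v * e + s * h"
      "?M $$ (2,0) = w * b'" "?M $$ (2,1) = w * e'"
      using c diag plane by (simp_all add: \<Phi>_def abc lh add_scalar_prod_distrib[of _ n])
    show ?thesis
      by (rule char_2_hollow_splits[OF 2 k(2) _ M(1-3) s3 refl refl, unfolded M, OF mat_carrier eq])
  qed
  have nz': "a \<noteq> 0" "a' \<noteq> 0" "b \<noteq> 0" "b' \<noteq> 0" "e \<noteq> 0" "e' \<noteq> 0" using nz by (simp_all add: abc)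
  have "a * e * b' + b * e' * a' = 0"
  proof (rule hollow_cycles_cancel[OF 2 sq k(1) nz'])
    fix u v w :: 'a
    assume "(u * v * (a * a') + u * w * (b * b') + v * w * (e * e')) ^ 3 = k * (u * v * w * (a * e * b' + b * e' * a'))\<^sup>2"
    then show "u * v * w * (a * e * b' + b * e' * a') = 0"
      using H[of u v 0 w] by (simp add: algebra_simps)
  qed
  from hollow_pencil_trivial[OF inf k(1) nz' this H] show ?thesis by (simp add: lh)
qed

text \<open>
  Induction on \<open>n\<close>. The cases \<open>n = 1\<close> and \<open>n = 2\<close> are direct; from \<open>n = 3\<close> on, a counterexample meets the
  conclusions of \<open>rank_one_square_zero_exists\<close> at every point and of \<open>square_zero_into_plane_exists\<close> at every
  plane spanned by two points of the moment curve.
\<close>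
theorem split_subspace_separated:
  fixes V :: "'a::field mat set"
  assumes nqc: "\<not> quadratically_closed TYPE('a)" and fin2: "\<not> (finite (UNIV :: 'a set) \<and> (2::'a) = 0)"
    and n: "n \<ge> 1" and V: "matrix_subspace n V" and split: "\<forall>A\<in>V. poly_splits (char_poly A)"
  shows "separated_by_forms n V (n * (n + 1) div 2)"
  using n V split
proof (induction n arbitrary: V rule: less_induct)
  case (less n)
  have split: "\<And>A. A \<in> V \<Longrightarrow> poly_splits (char_poly A)" using less.prems(3) by blast
  note V = less.prems(2)
  have IH: "separated_by_forms m W (m * (m + 1) div 2)"
    if "1 \<le> m" "m < n" "matrix_subspace m W" "\<forall>A\<in>W. poly_splits (char_poly A)" for m and W :: "'a mat set"
    using less.IH that by blast
  consider "n = 1" | "n = 2" | "n \<ge> 3" using less.prems(1) by linarith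
  then show ?case
  proof cases
    case 1
    have "A = 0\<^sub>m 1 1" if "A \<in> V" "A $$ (0,0) = 0" for A
      using that V 1 by (intro eq_matI) (auto simp: matrix_subspace_def)
    then have "separated_by_forms 1 V 1"
      unfolding separated_by_forms_def
      by (intro exI[of _ "[\<lambda>A. A $$ (0,0)]"]) (auto intro!: matrix_form_entry)
    then show ?thesis using 1 by simp
  next
    case 2
    then show ?thesis using separated_by_forms_2[OF nqc _ split] V by simp
  next
    case n3: 3
    show ?thesis
    proof (rule ccontr)
      assume nonsep: "\<not> ?thesis"
      have n2: "n \<ge> 2" using n3 by simp
      have "\<forall>x\<in>{x. x \<in> carrier_vec n \<and> x $ 0 = 1}. \<exists>\<phi>. \<phi> \<in> carrier_vec n \<and> \<phi> \<noteq> 0\<^sub>v n \<and> \<phi> \<bullet> x = 0 \<and> outer n [x] [\<phi>] \<in> V"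
        using rank_one_square_zero_exists[OF n2 V split IH nonsep] by blast
      from bchoice[OF this] obtain \<phi> where \<phi>_all: "\<forall>x\<in>{x. x \<in> carrier_vec n \<and> x $ 0 = 1}.
          \<phi> x \<in> carrier_vec n \<and> \<phi> x \<noteq> 0\<^sub>v n \<and> \<phi> x \<bullet> x = 0 \<and> outer n [x] [\<phi> x] \<in> V" ..
      have \<phi>: "\<phi> x \<in> carrier_vec n \<and> \<phi> x \<noteq> 0\<^sub>v n \<and> \<phi> x \<bullet> x = 0 \<and> outer n [x] [\<phi> x] \<in> V"
        if "x \<in> carrier_vec n" "x $ 0 = 1" for x
        using \<phi>_all that by blast
      have mom: "moment n t $ 0 = 1" for t :: 'a using n3 by (simp add: moment_def)
      have \<phi>m: "\<phi> (moment n t) \<in> carrier_vec n \<and> \<phi> (moment n t) \<noteq> 0\<^sub>v n \<and> \<phi> (moment n t) \<bullet> moment n t = 0" for t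
        using \<phi>[OF _ mom] by simp
      have "\<exists>x\<in>carrier_vec n. \<exists>y\<in>carrier_vec n. x $ 0 = 1 \<and> y $ 0 = 1 \<and> \<phi> x \<bullet> y \<noteq> 0 \<and> \<phi> y \<bullet> x \<noteq> 0"
      proof (cases "finite (UNIV :: 'a set)")
        case True
        show ?thesis by (rule mutual_pair_finite_field[OF True]) (use \<phi> n3 in auto)
      next
        case False
        obtain s t :: 'a where "\<phi> (moment n s) \<bullet> moment n t \<noteq> 0" "\<phi> (moment n t) \<bullet> moment n s \<noteq> 0"
          using mutual_moment_pair[OF False, of "\<lambda>t. \<phi> (moment n t)" n] \<phi>m by blast
        then show ?thesis using mom moment_carrier by blast
      qed
      then obtain x y where xy: "x \<in> carrier_vec n" "y \<in> carrier_vec n" "x $ 0 = 1" "y $ 0 = 1"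
        "\<phi> x \<bullet> y \<noteq> 0" "\<phi> y \<bullet> x \<noteq> 0" by blast
      have sq: "\<exists>r. r\<^sup>2 = a" for a :: 'a
        by (rule mutual_rank_ones_imp_all_squares[OF V split xy(1,2) _ _ _ _ _ _ xy(5,6)])
          (use \<phi>[OF xy(1,3)] \<phi>[OF xy(2,4)] in auto)
      have 2: "(2::'a) = 0" by (rule all_squares_imp_char_2[OF nqc sq])
      then have inf: "infinite (UNIV :: 'a set)" using fin2 by blast
      obtain T where T: "infinite T"
        "\<And>s t. s \<in> T \<Longrightarrow> t \<in> T \<Longrightarrow> s \<noteq> t \<Longrightarrow> \<phi> (moment n s) \<bullet> moment n t \<noteq> 0"
        using mutual_moment_clique[OF inf, of "\<lambda>t. \<phi> (moment n t)" n] \<phi>m by blast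
      obtain s where s: "s \<in> T" using T(1) by (metis ex_in_conv finite.emptyI)
      obtain t where t: "t \<in> T" "t \<noteq> s" using T(1) by (metis finite.emptyI finite_insert finite_subset insertCI subsetI)
      have st: "moment n s $ 1 \<noteq> moment n t $ 1" using n3 t by (simp add: moment_def)
      have "\<exists>\<xi> \<eta>. \<xi> \<in> carrier_vec n \<and> \<eta> \<in> carrier_vec n \<and> (\<xi> \<noteq> 0\<^sub>v n \<or> \<eta> \<noteq> 0\<^sub>v n)
          \<and> \<xi> \<bullet> moment n s = 0 \<and> \<xi> \<bullet> moment n t = 0 \<and> \<eta> \<bullet> moment n s = 0 \<and> \<eta> \<bullet> moment n t = 0
          \<and> outer n [moment n s, moment n t] [\<xi>, \<eta>] \<in> V"
        by (rule square_zero_into_plane_exists[OF n3 V split IH nonsep moment_carrier mom moment_carrier mom st])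
      then obtain \<xi> \<eta> where pl: "\<xi> \<in> carrier_vec n" "\<eta> \<in> carrier_vec n" "\<xi> \<noteq> 0\<^sub>v n \<or> \<eta> \<noteq> 0\<^sub>v n"
        "\<xi> \<bullet> moment n s = 0" "\<xi> \<bullet> moment n t = 0" "\<eta> \<bullet> moment n s = 0" "\<eta> \<bullet> moment n t = 0"
        "outer n [moment n s, moment n t] [\<xi>, \<eta>] \<in> V"
        by (elim exE conjE) (rule that)
      define Z where "Z = {z. \<xi> \<bullet> moment n z = 0 \<and> \<eta> \<bullet> moment n z = 0}"
      have "finite Z"
      proof (cases "\<xi> = 0\<^sub>v n")
        case True
        then have "finite {z. \<eta> \<bullet> moment n z = 0}" using card_moment_zeros(1)[OF pl(2)] pl(3) by blast
        then show ?thesis by (rule finite_subset[rotated]) (auto simp: Z_def)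
      next
        case False
        then have "finite {z. \<xi> \<bullet> moment n z = 0}" using card_moment_zeros(1)[OF pl(1)] by blast
        then show ?thesis by (rule finite_subset[rotated]) (auto simp: Z_def)
      qed
      then have "infinite (T - (Z \<union> {s, t}))" using T(1) by simp
      then obtain z where "z \<in> T - (Z \<union> {s, t})" by (metis ex_in_conv finite.emptyI)
      then have z: "z \<in> T" "z \<noteq> s" "z \<noteq> t" "z \<notin> Z" by auto
      have "\<xi> \<bullet> moment n z = 0 \<and> \<eta> \<bullet> moment n z = 0"
      proof (rule square_zero_into_plane_kills_third_point[OF nqc 2 sq inf V split, where x = "moment n s" and y = "moment n t"
            and \<phi> = "\<phi> (moment n s)" and \<psi> = "\<phi> (moment n t)" and \<chi> = "\<phi> (moment n z)"])
      qed (use \<phi>[OF moment_carrier mom] pl T(2) s t z in auto)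
      then show False using z(4) by (simp add: Z_def)
    qed
  qed
qed

section \<open>Spaces that attain or exceed the bound\<close>

text \<open>
  For an eigenvalue \<open>r\<close> and a nonzero lower left entry \<open>c\<close>, the vector \<open>(r - d, c)\<close> is an eigenvector; the
  first unit vector completes it to a basis, the columns of \<open>P\<close>.
\<close>
lemma triangularizable_2:
  fixes A :: "'a::field mat"
  assumes qc: "quadratically_closed TYPE('a)" and A: "A \<in> carrier_mat 2 2"
  shows "triangularizable A"
proof (cases "A $$ (1,0) = 0")
  case True
  then have "upper_triangular A" using A by (auto simp: upper_triangular_def less_2_cases_iff)
  then show ?thesis unfolding triangularizable_def using similar_mat_refl[OF A] by blast
next
  case c0: False
  define a b c d where abcd: "a = A $$ (0,0)" "b = A $$ (0,1)" "c = A $$ (1,0)" "d = A $$ (1,1)"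
  obtain r where r: "r\<^sup>2 + (- (a + d)) * r + (a * d - b * c) = 0" using quadratically_closed_root[OF qc] by blast
  have c: "c \<noteq> 0" using c0 by (simp add: abcd)
  define P where "P = mat_of_rows_list 2 [[r - d, 1], [c, 0]]"
  define Q where "Q = mat_of_rows_list 2 [[0, 1 / c], [1, (d - r) / c]]"
  define B where "B = mat_of_rows_list 2 [[r, 1], [0, a + d - r]]"
  have PQB: "P \<in> carrier_mat 2 2" "Q \<in> carrier_mat 2 2" "B \<in> carrier_mat 2 2"
    by (auto simp: P_def Q_def B_def mat_of_rows_list_def)
  have mult: "(M * N) $$ (i, j) = M $$ (i,0) * N $$ (0,j) + M $$ (i,1) * N $$ (1,j)"
    if "M \<in> carrier_mat 2 2" "N \<in> carrier_mat 2 2" "i < 2" "j < 2" for M N :: "'a mat" and i j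
    using that by (simp add: scalar_prod_def numeral_2_eq_2)
  have mults: "(M * N) $$ (0, 0) = M $$ (0,0) * N $$ (0,0) + M $$ (0,1) * N $$ (1,0)"
    "(M * N) $$ (0, 1) = M $$ (0,0) * N $$ (0,1) + M $$ (0,1) * N $$ (1,1)"
    "(M * N) $$ (1, 0) = M $$ (1,0) * N $$ (0,0) + M $$ (1,1) * N $$ (1,0)"
    "(M * N) $$ (1, 1) = M $$ (1,0) * N $$ (0,1) + M $$ (1,1) * N $$ (1,1)"
    if "M \<in> carrier_mat 2 2" "N \<in> carrier_mat 2 2" for M N :: "'a mat"
    by (rule mult[OF that], simp, simp)+
  have ent: "P $$ (0,0) = r - d" "P $$ (0,1) = 1" "P $$ (1,0) = c" "P $$ (1,1) = 0"
    "Q $$ (0,0) = 0" "Q $$ (0,1) = 1 / c" "Q $$ (1,0) = 1" "Q $$ (1,1) = (d - r) / c"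
    "B $$ (0,0) = r" "B $$ (0,1) = 1" "B $$ (1,0) = 0" "B $$ (1,1) = a + d - r"
    by (simp_all add: P_def Q_def B_def mat_of_rows_list_def)
  have eqI: "M = N" if "M \<in> carrier_mat 2 2" "N \<in> carrier_mat 2 2" "M $$ (0,0) = N $$ (0,0)"
    "M $$ (0,1) = N $$ (0,1)" "M $$ (1,0) = N $$ (1,0)" "M $$ (1,1) = N $$ (1,1)" for M N :: "'a mat"
    using that by (intro eq_matI) (auto simp: less_2_cases_iff)
  have PQ: "P * Q = 1\<^sub>m 2"
    by (rule eqI, use PQB in simp, simp, unfold mults[OF PQB(1,2)] ent) (use c in \<open>simp_all add: field_simps\<close>)
  have QP: "Q * P = 1\<^sub>m 2" by (rule mat_mult_left_right_inverse[OF PQB(1,2) PQ])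
  have AP: "A * P = P * B"
  proof (rule eqI)
    have "a * (r - d) + b * c - (r - d) * r = - (r\<^sup>2 + (- (a + d)) * r + (a * d - b * c))"
      by (simp add: power2_eq_square algebra_simps)
    also have "\<dots> = 0" unfolding r by simp
    finally have k: "a * (r - d) + b * c = (r - d) * r" by simp
    show "(A * P) $$ (0, 0) = (P * B) $$ (0, 0)"
      unfolding mults[OF A PQB(1)] mults[OF PQB(1,3)] ent abcd[symmetric] using k by simp
    show "(A * P) $$ (0, 1) = (P * B) $$ (0, 1)"
      unfolding mults[OF A PQB(1)] mults[OF PQB(1,3)] ent abcd[symmetric] by simp
    show "(A * P) $$ (1, 0) = (P * B) $$ (1, 0)"
      unfolding mults[OF A PQB(1)] mults[OF PQB(1,3)] ent abcd[symmetric] by (simp add: algebra_simps)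
    show "(A * P) $$ (1, 1) = (P * B) $$ (1, 1)"
      unfolding mults[OF A PQB(1)] mults[OF PQB(1,3)] ent abcd[symmetric] by simp
  qed (use A PQB in auto)
  have "P * B * Q = A * (P * Q)" using A PQB by (simp add: AP[symmetric])
  then have "A = P * B * Q" using A by (simp add: PQ)
  then have "similar_mat A B" by (intro similar_matI[OF _ PQ QP]) (use A PQB in auto)
  moreover have "upper_triangular B"
    using PQB ent by (auto simp: upper_triangular_def less_2_cases_iff)
  ultimately show ?thesis unfolding triangularizable_def by blast
qed

definition upper_positions :: "nat \<Rightarrow> (nat \<times> nat) set" where
  "upper_positions n = {(i, j). i \<le> j \<and> j < n}"

lemma upper_positions_subset: "upper_positions n \<subseteq> {..<n} \<times> {..<n}"
  by (auto simp: upper_positions_def)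

lemma card_upper_positions: "card (upper_positions n) = n * (n + 1) div 2"
proof -
  have "upper_positions n = prod.swap ` (SIGMA j:{..<n}. {..j})"
    by (auto simp: upper_positions_def image_iff)
  then have "card (upper_positions n) = card (SIGMA j:{..<n}. {..j})"
    by (simp add: card_image)
  also have "\<dots> = (\<Sum>j<n. Suc j)" by simp
  also have "\<dots> = n * (n + 1) div 2" by (induction n) auto
  finally show ?thesis .
qed

lemma coordinate_upper_triangular:
  fixes A :: "'a::field mat"
  assumes "A \<in> coordinate_subspace n (upper_positions n)"
  shows "triangularizable A"
proof -
  have A: "A \<in> carrier_mat n n" using assms by (simp add: coordinate_subspace_def)
  have "upper_triangular A"
    using assms A by (auto simp: coordinate_subspace_def upper_positions_def upper_triangular_def)
  then show ?thesis unfolding triangularizable_def using similar_mat_refl[OF A] by blast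
qed

text \<open>
  Such a matrix is block upper triangular, with one \<open>2 \<times> 2\<close> block that is triangularizable by
  \<open>triangularizable_2\<close> and a second block that is already upper triangular.
\<close>
lemma coordinate_upper_insert_1_0_triangularizable:
  fixes A :: "'a::field mat"
  assumes qc: "quadratically_closed TYPE('a)" and n: "n \<ge> 2"
    and A: "A \<in> coordinate_subspace n (insert (1, 0) (upper_positions n))"
  shows "triangularizable A"
proof -
  obtain m where m: "n = 2 + m" using n by (metis le_iff_add)
  have Ac: "A \<in> carrier_mat n n"
    and z: "\<And>i j. i < n \<Longrightarrow> j < i \<Longrightarrow> (i, j) \<noteq> (1, 0) \<Longrightarrow> A $$ (i, j) = 0"
    using A by (auto simp: coordinate_subspace_def upper_positions_def)
  define A1 where "A1 = mat 2 2 (\<lambda>p. A $$ p)"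
  define A2 where "A2 = mat 2 m (\<lambda>(i,j). A $$ (i, j + 2))"
  define A4 where "A4 = mat m m (\<lambda>(i,j). A $$ (i + 2, j + 2))"
  have c: "A1 \<in> carrier_mat 2 2" "A2 \<in> carrier_mat 2 m" "A4 \<in> carrier_mat m m"
    by (auto simp: A1_def A2_def A4_def)
  have blk: "A = four_block_mat A1 A2 (0\<^sub>m m 2) A4"
  proof (rule eq_matI)
    fix i j assume "i < dim_row (four_block_mat A1 A2 (0\<^sub>m m 2) A4)" "j < dim_col (four_block_mat A1 A2 (0\<^sub>m m 2) A4)"
    then have ij: "i < n" "j < n" using c m by auto
    show "A $$ (i, j) = four_block_mat A1 A2 (0\<^sub>m m 2) A4 $$ (i, j)"
    proof (cases "i < 2 \<or> 2 \<le> j")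
      case True
      have "Suc (Suc (l - 2)) = l" if "\<not> l < 2" for l using that by simp
      then show ?thesis using True ij m by (auto simp: A1_def A2_def A4_def)
    next
      case False
      then have "A $$ (i, j) = 0" using ij by (intro z) auto
      then show ?thesis using ij m c False by auto
    qed
  qed (use Ac c m in auto)
  obtain B where B: "similar_mat A1 B" "upper_triangular B"
    using triangularizable_2[OF qc c(1)] unfolding triangularizable_def by blast
  have Bc: "B \<in> carrier_mat 2 2" using similar_matD[OF B(1)] c(1) by auto
  have "upper_triangular A4" using z m by (auto simp: A4_def upper_triangular_def)
  moreover obtain B0 where "similar_mat A (four_block_mat B B0 (0\<^sub>m m 2) A4)"
    using similar_mat_four_block_0_ex[OF B(1) similar_mat_refl[OF c(3)] c(2,1,3)] blk by auto
  ultimately show ?thesis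
    unfolding triangularizable_def using upper_triangular_four_block[OF Bc c(3) B(2)] by blast
qed

lemma separated_by_entries:
  assumes "matrix_subspace n W"
  shows "separated_by_forms n W (n * n)"
  unfolding separated_by_forms_def
proof (intro exI conjI)
  let ?fs = "map (\<lambda>p A. A $$ p) (List.product [0..<n] [0..<n])"
  show "length ?fs = n * n" by simp
  show "\<forall>f\<in>set ?fs. matrix_form n f" by (auto intro!: matrix_form_entry)
  show "\<forall>A\<in>W. (\<forall>f\<in>set ?fs. f A = 0) \<longrightarrow> A = 0\<^sub>m n n"
  proof (intro ballI impI)
    fix A assume A: "A \<in> W" and z: "\<forall>f\<in>set ?fs. f A = 0"
    then have "A \<in> carrier_mat n n" using assms by (auto simp: matrix_subspace_def)
    then show "A = 0\<^sub>m n n" using z by (intro eq_matI) auto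
  qed
qed

theorem theorem1p1:
  fixes n :: nat
  assumes "n \<ge> 2"
    and "\<not> (finite (UNIV :: 'a::field set) \<and> CHAR('a) = 2)"
  shows "triang_dim TYPE('a) n = n * (n + 1) div 2 \<longleftrightarrow> \<not> quadratically_closed TYPE('a)"
proof -
  define D where "D = {mat_subspace_dim n W | W :: 'a mat set. weakly_triangularizable_subspace n W}"
  have weak: "weakly_triangularizable_subspace n W \<longleftrightarrow> matrix_subspace n W \<and> (\<forall>A\<in>W. triangularizable A)"
    for W :: "'a mat set"
    by (simp add: weakly_triangularizable_subspace_def matrix_subspace_iff)
  have "D \<subseteq> {..n * n}"
    unfolding D_def weak using mat_subspace_dim_le separated_by_entries by blast
  then have fin: "finite D" by (rule finite_subset) simp
  have dim: "triang_dim TYPE('a) n = Max D" by (simp add: triang_dim_def D_def)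
  have U: "n * (n + 1) div 2 \<in> D"
    unfolding D_def weak
    using matrix_subspace_coordinate[of n "upper_positions n"] coordinate_upper_triangular
      mat_subspace_dim_coordinate[OF upper_positions_subset, of n] card_upper_positions[of n]
    by (smt (verit, best) mem_Collect_eq)
  show ?thesis
  proof (cases "quadratically_closed TYPE('a)")
    case True
    let ?I = "insert (1, 0) (upper_positions n)"
    have fI: "finite (upper_positions n)" using upper_positions_subset by (rule finite_subset) simp
    have "?I \<subseteq> {..<n} \<times> {..<n}" using upper_positions_subset assms(1) by auto
    moreover have "card ?I = n * (n + 1) div 2 + 1"
      using fI card_upper_positions[of n] by (simp add: card_insert_if upper_positions_def)
    ultimately have "mat_subspace_dim n (coordinate_subspace n ?I :: 'a mat set) = n * (n + 1) div 2 + 1"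
      using mat_subspace_dim_coordinate by metis
    then have "n * (n + 1) div 2 + 1 \<in> D"
      unfolding D_def weak
      using matrix_subspace_coordinate[of n ?I] coordinate_upper_insert_1_0_triangularizable[OF True assms(1)]
      by (smt (verit, best) mem_Collect_eq)
    then have "n * (n + 1) div 2 + 1 \<le> Max D" using fin by (rule Max_ge[rotated])
    then show ?thesis using True dim by simp
  next
    case False
    have "CHAR('a) = 2" if "(2::'a) = 0"
    proof -
      have "CHAR('a) dvd 2" using that of_nat_eq_0_iff_char_dvd[of 2, where 'a = 'a] by simp
      moreover have "CHAR('a) \<noteq> 1" using CHAR_not_1[where 'a = 'a] by simp
      ultimately show ?thesis using two_is_prime_nat prime_nat_iff by blast
    qed
    then have fin2: "\<not> (finite (UNIV :: 'a set) \<and> (2::'a) = 0)" using assms(2) by blast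
    have "d \<le> n * (n + 1) div 2" if d: "d \<in> D" for d
    proof -
      obtain W :: "'a mat set" where W: "d = mat_subspace_dim n W" "matrix_subspace n W" "\<forall>A\<in>W. triangularizable A"
        using d unfolding D_def weak by blast
      have "separated_by_forms n W (n * (n + 1) div 2)"
        by (rule split_subspace_separated[OF False fin2 _ W(2)])
          (use assms(1) W(3) triangularizable_imp_char_poly_splits in auto)
      then show ?thesis using mat_subspace_dim_le[OF W(2)] W(1) by simp
    qed
    then have "Max D = n * (n + 1) div 2" using fin U by (intro Max_eqI) auto
    then show ?thesis using False dim by simp
  qed
qed

end
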